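(* Let $\mathcal B$ be a basis with equivalence classes $\mathcal B_j$ and $\Omega_j=\bigcup_{B\in\mathcal B_j}B$, let $W$ be an extended-valued, self-adjoint, positive semidefinite matrix function on $\Omega=\bigcup_{B\in\mathcal B}B$, let $1<p<\infty$, and suppose that $\mathcal B$ has the weak matrix Muckenhoupt property for $W$ and $p$. Then for each $j$, one of the following holds: (1) $W$ is non-trivial on $\Omega_j$: that is, for every $v\in\mathbb R^d$, $v\ne0$, and for almost every $x\in\Omega_j$, $0<|W(x)v|<\infty$; (2) $W$ is trivial on $\Omega_j$: there exists a vector $v\in\mathbb R^d$, $v\neq0$, such that $|W(x)v|=0$ for almost every $x\in\Omega_j$, or $|W(x)v|=\infty$ for almost every $x\in\Omega_j$. Let $\mathcal B^*$ be the union of all $\mathcal B_j$ such that $W$ is non-trivial on $\Omega_j$, and let $\Omega^*=\bigcup_{B\in\mathcal B^*}B$. Then $W$ is finite and invertible almost everywhere on $\Omega^*$, and in fact $|W|_{\mathrm{op}}\in L^p_{\mathrm{loc}}(\Omega^* )$ and $|W^{-1}|_{\mathrm{op}}\in L^{p'}_{\mathrm{loc}}(\Omega^* )$. Moreover, $W\in\mathcal A_{p,\mathcal B^*}$: $$\sup_{B\in\mathcal B^*}\left(\frac1{|B|}\int_B\left(\frac1{|B|}\int_B|W(x)W^{-1}(y)|_{\mathrm{op}}^{p'}\,dy\right)^{\frac p{p'}}dx\right)^{\frac1p}<\infty.$$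
   Context: A basis $\mathcal B$ is a collection of nonempty open subsets of $\mathbb R^n$ of finite measure. For $B,B'\in\mathcal B$, write $B\approx B'$ if there is a finite sequence $B_0=B,B_1,\dots,B_k=B'$ in $\mathcal B$ with $B_{i-1}\cap B_i\ne\emptyset$ for $1\le i\le k$; this is an equivalence relation, with equivalence classes $\mathcal B_j$. The matrix function $W$: a $d\times d$ measurable matrix function on $\Omega$ whose components take values in $[-\infty,\infty]$ (extended by zero to $\mathbb R^n\setminus\Omega$), self-adjoint and positive semidefinite in the sense that $\langle W(x)v,v\rangle\ge0$ for every $v\in\mathbb R^d$ and almost every $x\in\Omega$, where all products use the conventions $0\cdot\infty=0$ and $s\cdot\infty+t\cdot\infty=\operatorname{sgn}(s+t)\infty$. For $f=(f_1,\dots,f_d)$ with each $f_i$ measurable with values in $[-\infty,\infty]$, $W(x)f(x)$ is defined with the same conventions; the Euclidean norm of a vector with an infinite component is $\infty$. $L^p(\mathbb R^n,W)$ is the set of all such $f$ with $\int_{\mathbb R^n}|W(x)f(x)|^p\,dx<\infty$. Define $$\widetilde M_{W,\mathcal B}f(x)=\sup_{B\in\mathcal B}\frac1{|B|}\int_B|W(x)f(y)|\,dy\cdot\chi_B(x).$$ $\mathcal B$ has the weak matrix Muckenhoupt property for $W$ and $p$ if $\widetilde M_{W,\mathcal B}:L^p(\mathbb R^n,W)\to L^p(\mathbb R^n)$ is bounded, i.e. there is $C<\infty$ with $\|\widetilde M_{W,\mathcal B}f\|_{L^p(\mathbb R^n)}\le C\big(\int_{\mathbb R^n}|W(x)f(x)|^p\,dx\big)^{1/p}$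 for all $f\in L^p(\mathbb R^n,W)$. "$W$ is finite and invertible a.e." means that for a.e. $x$ all entries of $W(x)$ are finite and $W(x)$ is invertible. $|A|_{\mathrm{op}}=\sup_{|v|=1}|Av|$, and $\frac1p+\frac1{p'}=1$. *)

theory Defs
  imports "HOL-Analysis.Analysis"
begin

section \<open>Extended-valued vectors and matrices\<close>

text \<open>
  The sum of \<^typ>\<open>ereal\<close> has \<open>\<infinity> + (-\<infinity>) = \<infinity>\<close>, so it does not
  implement the conventions \<open>0 \<cdot> \<infinity> = 0\<close> and \<open>s \<cdot> \<infinity> + t \<cdot> \<infinity> = sgn (s + t) \<cdot> \<infinity>\<close>.  We write
  \<open>x = fin_part x + inf_sign x \<cdot> \<infinity>\<close>, expand \<open>\<Sum>k. a k \<cdot> b k\<close> formally in powers of the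
  symbol \<open>\<infinity>\<close>, and apply the conventions to the collected coefficients: the highest power of
  \<open>\<infinity>\<close> with a nonzero coefficient decides, and the value is the finite part if there is
  none.  The quadratic term only occurs when both factors are infinite.
\<close>

definition fin_part :: "ereal \<Rightarrow> real" where
  "fin_part x = real_of_ereal x"

definition inf_sign :: "ereal \<Rightarrow> real" where
  "inf_sign x = (if x = \<infinity> then 1 else if x = - \<infinity> then - 1 else 0)"

definition ext_dot :: "ereal ^ 'd \<Rightarrow> ereal ^ 'd \<Rightarrow> ereal" where
  "ext_dot a b =
    (let c0 = (\<Sum>k\<in>UNIV. fin_part (a $ k) * fin_part (b $ k));
         c1 = (\<Sum>k\<in>UNIV. inf_sign (a $ k) * fin_part (b $ k) + fin_part (a $ k) * inf_sign (b $ k));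
         c2 = (\<Sum>k\<in>UNIV. inf_sign (a $ k) * inf_sign (b $ k))
     in if c2 \<noteq> 0 then ereal (sgn c2) * \<infinity>
        else if c1 \<noteq> 0 then ereal (sgn c1) * \<infinity>
        else ereal c0)"

definition ext_mult_vec :: "ereal ^ 'd ^ 'd \<Rightarrow> ereal ^ 'd \<Rightarrow> ereal ^ 'd" where
  "ext_mult_vec A v = (\<chi> i. ext_dot (A $ i) v)"

definition ext_mult_mat :: "ereal ^ 'd ^ 'd \<Rightarrow> ereal ^ 'd ^ 'd \<Rightarrow> ereal ^ 'd ^ 'd" where
  "ext_mult_mat A B = (\<chi> i j. ext_dot (A $ i) (\<chi> k. B $ k $ j))"

definition ext_vec :: "real ^ 'd \<Rightarrow> ereal ^ 'd" where
  "ext_vec v = (\<chi> i. ereal (v $ i))"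

definition ext_norm :: "ereal ^ 'd \<Rightarrow> ennreal" where
  "ext_norm v =
    (if \<exists>i. \<bar>v $ i\<bar> = \<infinity> then \<infinity> else ennreal (norm (\<chi> i. real_of_ereal (v $ i))))"

definition ext_op_norm :: "ereal ^ 'd ^ 'd \<Rightarrow> ennreal" where
  "ext_op_norm A = (SUP v\<in>{v. norm v = 1}. ext_norm (ext_mult_vec A (ext_vec v)))"

definition finite_matrix :: "ereal ^ 'd ^ 'd \<Rightarrow> bool" where
  "finite_matrix A \<longleftrightarrow> (\<forall>i j. \<bar>A $ i $ j\<bar> \<noteq> \<infinity>)"

definition real_matrix :: "ereal ^ 'd ^ 'd \<Rightarrow> real ^ 'd ^ 'd" where
  "real_matrix A = (\<chi> i j. real_of_ereal (A $ i $ j))"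

definition finite_invertible :: "ereal ^ 'd ^ 'd \<Rightarrow> bool" where
  "finite_invertible A \<longleftrightarrow> finite_matrix A \<and> invertible (real_matrix A)"

text \<open>Only meaningful for \<^const>\<open>finite_invertible\<close> matrices; otherwise a junk value.\<close>

definition ext_inv :: "ereal ^ 'd ^ 'd \<Rightarrow> ereal ^ 'd ^ 'd" where
  "ext_inv A = (\<chi> i j. ereal (matrix_inv (real_matrix A) $ i $ j))"


section \<open>Bases\<close>

definition basis_family :: "(real ^ 'n) set set \<Rightarrow> bool" where
  "basis_family \<B> \<longleftrightarrow> (\<forall>B\<in>\<B>. open B \<and> B \<noteq> {} \<and> emeasure lebesgue B < \<infinity>)"

definition chain_rel :: "'a set set \<Rightarrow> 'a set rel" where
  "chain_rel \<B> =
    {(B, B'). \<exists>(S :: nat \<Rightarrow> 'a set) k. S 0 = B \<and> S k = B' \<and>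
       (\<forall>i\<le>k. S i \<in> \<B>) \<and> (\<forall>i\<in>{1..k}. S (i - 1) \<inter> S i \<noteq> {})}"


section \<open>Function spaces\<close>

text \<open>Meant for exponents \<open>p > 0\<close>.\<close>

definition enn_powr :: "ennreal \<Rightarrow> real \<Rightarrow> ennreal" where
  "enn_powr x p = (if x = \<infinity> then \<infinity> else ennreal (enn2real x powr p))"

definition Lp_norm :: "real \<Rightarrow> (real ^ 'n \<Rightarrow> ennreal) \<Rightarrow> ennreal" where
  "Lp_norm p g = enn_powr (\<integral>\<^sup>+x. enn_powr (g x) p \<partial>lebesgue) (1 / p)"

definition Lp_loc :: "real \<Rightarrow> (real ^ 'n) set \<Rightarrow> (real ^ 'n \<Rightarrow> ennreal) set" where
  "Lp_loc p U = {g. g \<in> borel_measurable (lebesgue_on U) \<and>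
     (\<forall>K. compact K \<and> K \<subseteq> U \<longrightarrow> (\<integral>\<^sup>+x\<in>K. enn_powr (g x) p \<partial>lebesgue) < \<infinity>)}"

definition avg :: "(real ^ 'n) set \<Rightarrow> (real ^ 'n \<Rightarrow> ennreal) \<Rightarrow> ennreal" where
  "avg B g = (\<integral>\<^sup>+x\<in>B. g x \<partial>lebesgue) / emeasure lebesgue B"


section \<open>Extended-valued matrix weights\<close>

text \<open>
  A matrix function on \<open>\<Omega>\<close> is identified with its extension by zero.
\<close>

definition ext_matrix_function ::
    "(real ^ 'n) set \<Rightarrow> (real ^ 'n \<Rightarrow> ereal ^ 'd ^ 'd) \<Rightarrow> bool" where
  "ext_matrix_function \<Omega> W \<longleftrightarrow>
     (\<forall>i j. (\<lambda>x. W x $ i $ j) \<in> borel_measurable lebesgue) \<and>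
     (\<forall>x. x \<notin> \<Omega> \<longrightarrow> (\<forall>i j. W x $ i $ j = 0))"

definition self_adjoint_ae ::
    "(real ^ 'n) set \<Rightarrow> (real ^ 'n \<Rightarrow> ereal ^ 'd ^ 'd) \<Rightarrow> bool" where
  "self_adjoint_ae \<Omega> W \<longleftrightarrow> (AE x in lebesgue. x \<in> \<Omega> \<longrightarrow> transpose (W x) = W x)"

definition pos_semidef_ae ::
    "(real ^ 'n) set \<Rightarrow> (real ^ 'n \<Rightarrow> ereal ^ 'd ^ 'd) \<Rightarrow> bool" where
  "pos_semidef_ae \<Omega> W \<longleftrightarrow>
     (\<forall>v :: real ^ 'd. AE x in lebesgue. x \<in> \<Omega> \<longrightarrow>
        0 \<le> ext_dot (ext_mult_vec (W x) (ext_vec v)) (ext_vec v))"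

definition Lp_weighted ::
    "real \<Rightarrow> (real ^ 'n \<Rightarrow> ereal ^ 'd ^ 'd) \<Rightarrow> (real ^ 'n \<Rightarrow> ereal ^ 'd) set" where
  "Lp_weighted p W = {f. (\<forall>i. (\<lambda>x. f x $ i) \<in> borel_measurable lebesgue) \<and>
     (\<integral>\<^sup>+x. enn_powr (ext_norm (ext_mult_vec (W x) (f x))) p \<partial>lebesgue) < \<infinity>}"

definition maximal_op ::
    "(real ^ 'n) set set \<Rightarrow> (real ^ 'n \<Rightarrow> ereal ^ 'd ^ 'd) \<Rightarrow> (real ^ 'n \<Rightarrow> ereal ^ 'd) \<Rightarrow>
      real ^ 'n \<Rightarrow> ennreal" where
  "maximal_op \<B> W f x =
     (SUP B\<in>\<B>. avg B (\<lambda>y. ext_norm (ext_mult_vec (W x) (f y))) * indicator B x)"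

definition weak_muckenhoupt ::
    "(real ^ 'n) set set \<Rightarrow> (real ^ 'n \<Rightarrow> ereal ^ 'd ^ 'd) \<Rightarrow> real \<Rightarrow> bool" where
  "weak_muckenhoupt \<B> W p \<longleftrightarrow>
     (\<exists>C :: real. \<forall>f \<in> Lp_weighted p W.
        Lp_norm p (maximal_op \<B> W f)
          \<le> ennreal C * Lp_norm p (\<lambda>x. ext_norm (ext_mult_vec (W x) (f x))))"

definition nontrivial_on ::
    "(real ^ 'n \<Rightarrow> ereal ^ 'd ^ 'd) \<Rightarrow> (real ^ 'n) set \<Rightarrow> bool" where
  "nontrivial_on W U \<longleftrightarrow>
     (\<forall>v :: real ^ 'd. v \<noteq> 0 \<longrightarrow>
        (AE x in lebesgue. x \<in> U \<longrightarrow>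
           0 < ext_norm (ext_mult_vec (W x) (ext_vec v)) \<and>
           ext_norm (ext_mult_vec (W x) (ext_vec v)) < \<infinity>))"

definition trivial_on ::
    "(real ^ 'n \<Rightarrow> ereal ^ 'd ^ 'd) \<Rightarrow> (real ^ 'n) set \<Rightarrow> bool" where
  "trivial_on W U \<longleftrightarrow>
     (\<exists>v :: real ^ 'd. v \<noteq> 0 \<and>
        ((AE x in lebesgue. x \<in> U \<longrightarrow> ext_norm (ext_mult_vec (W x) (ext_vec v)) = 0) \<or>
         (AE x in lebesgue. x \<in> U \<longrightarrow> ext_norm (ext_mult_vec (W x) (ext_vec v)) = \<infinity>)))"

definition nontrivial_part ::
    "(real ^ 'n) set set \<Rightarrow> (real ^ 'n \<Rightarrow> ereal ^ 'd ^ 'd) \<Rightarrow> (real ^ 'n) set set" where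
  "nontrivial_part \<B> W = \<Union> {\<C> \<in> \<B> // chain_rel \<B>. nontrivial_on W (\<Union>\<C>)}"

definition Ap_const ::
    "(real ^ 'n) set set \<Rightarrow> (real ^ 'n \<Rightarrow> ereal ^ 'd ^ 'd) \<Rightarrow> real \<Rightarrow> real \<Rightarrow> ennreal" where
  "Ap_const \<B> W p p' =
     (SUP B\<in>\<B>. enn_powr
        (avg B (\<lambda>x. enn_powr
           (avg B (\<lambda>y. enn_powr (ext_op_norm (ext_mult_mat (W x) (ext_inv (W y)))) p'))
           (p / p')))
        (1 / p))"

end

theory Submission
  imports Defs
begin

text \<open>
  The weak Muckenhoupt property is used only through averages over one basis set at a time.  For
  \<open>B\<close> in the basis and \<open>f\<close> supported in \<open>B\<close>, the maximal function at \<open>x \<in> B\<close> is at least the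
  average over \<open>B\<close> of \<open>\<bar>W(x) f(y)\<bar>\<close> in \<open>y\<close>.  Hence, with one constant \<open>C\<close> for all \<open>B\<close>,
  the \<open>L\<^sup>p(B)\<close> norm of this average is at most \<open>C\<close> times that of \<open>W f\<close>.

  Dichotomy.  Testing with \<open>f = 1\<^sub>E v\<close> for \<open>E \<subseteq> B\<close> gives
  \<open>(\<bar>E\<bar> / \<bar>B\<bar>)\<^sup>p \<integral>\<^sub>B \<bar>W v\<bar>\<^sup>p \<le> C\<^sup>p \<integral>\<^sub>E \<bar>W v\<bar>\<^sup>p\<close> (\<open>doubling\<close>).  If \<open>W v\<close> vanishes on a
  subset of \<open>B\<close> of positive measure, it therefore vanishes almost everywhere on \<open>B\<close>, and if
  it is finite on a subset of positive measure, then \<open>\<bar>W v\<bar>\<^sup>p\<close> is integrable over \<open>B\<close>.  Intersecting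
  basis sets overlap in positive measure, so for a fixed \<open>v\<close> the alternatives ``zero a.e.'' and
  ``infinite a.e.'' spread along chains, and countably many sets of a class already cover its union
  (\<open>dichotomy\<close>).

  Nontrivial classes.  Now fix \<open>B\<close> in a nontrivial class; there \<open>W\<close> is a.e. a finite symmetric
  positive semidefinite matrix.  Put \<open>N(v) = avg\<^sub>B \<bar>W v\<bar>\<^sup>p\<close>, which is finite and positive for \<open>v \<noteq> 0\<close>.
  Taking the average of \<open>f\<close> inside the norm shows \<open>N(avg\<^sub>B f) \<le> C\<^sup>p avg\<^sub>B \<bar>W f\<bar>\<^sup>p\<close>: averaging is
  bounded on \<open>L\<^sup>p(W)\<close>.  Duality turns this into a bound on the inverse: for every \<open>u\<close> with
  \<open>\<bar>u \<bullet> w\<bar> \<le> 1\<close> on the unit ball of \<open>N\<close>, the average of \<open>\<bar>W\<^sup>-\<^sup>1 u\<bar>\<close> to the power \<open>p'\<close> is bounded in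
  terms of \<open>C\<close>.  Since invertibility of \<open>W\<close> is not known beforehand, this is done for the
  resolvents \<open>(W + \<epsilon>)\<^sup>-\<^sup>1\<close> with a bound free of \<open>\<epsilon>\<close> (\<open>dual_estimate_resolvent\<close>).  They blow up as
  \<open>\<epsilon> \<rightarrow> 0\<close> where \<open>W\<close> is singular, so Fatou's lemma yields both invertibility a.e. and the
  estimate for \<open>W\<^sup>-\<^sup>1\<close>.

  The kernel.  The unit ball of \<open>N\<close> carries an Auerbach basis: vectors \<open>v\<^sub>i\<close> with \<open>N(v\<^sub>i) \<le> 1\<close> whose
  dual basis \<open>u\<^sub>i\<close> is bounded by 1 on the unit ball (\<open>auerbach_basis\<close>).  Expanding
  the identity matrix as \<open>\<Sum>\<^sub>i v\<^sub>i u\<^sub>i\<^sup>T\<close> in the product \<open>W(x) W\<^sup>-\<^sup>1(y)\<close> gives the separated bound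
  \<open>\<bar>W(x) W\<^sup>-\<^sup>1(y)\<bar> \<le> (\<Sum>\<^sub>i \<bar>W(x) v\<^sub>i\<bar>) (\<Sum>\<^sub>i \<bar>W\<^sup>-\<^sup>1(y) u\<^sub>i\<bar>)\<close>, whose factors are controlled in \<open>L\<^sup>p\<close> and
  \<open>L\<^sup>p\<^sup>'\<close> averages by constants depending on \<open>d\<close>, \<open>p\<close>, \<open>C\<close> only (\<open>kernel_factorization\<close>).
  This is the \<open>A\<^sub>p\<close> condition, and the same factors dominate \<open>W\<close> and \<open>W\<^sup>-\<^sup>1\<close> themselves, which
  gives local integrability.
\<close>

section \<open>Powers of extended nonnegative numbers\<close>

lemma enn_powr_ennreal: "0 \<le> r \<Longrightarrow> enn_powr (ennreal r) p = ennreal (r powr p)"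
  by (simp add: enn_powr_def)

lemma enn_powr_simps [simp]: "enn_powr 0 p = 0" "enn_powr top p = top" "enn_powr 1 p = 1"
  by (simp_all add: enn_powr_def)

lemma enn_powr_mono: "x \<le> y \<Longrightarrow> 0 \<le> p \<Longrightarrow> enn_powr x p \<le> enn_powr y p"
  by (cases x; cases y) (auto simp: enn_powr_ennreal top_unique intro!: ennreal_leI powr_mono2)

lemma enn_powr_eq_0_iff [simp]: "enn_powr x p = 0 \<longleftrightarrow> x = 0"
  by (cases x) (auto simp: enn_powr_ennreal)

lemma enn_powr_less_top_iff [simp]: "enn_powr x p < top \<longleftrightarrow> x < top"
  by (cases x) (auto simp: enn_powr_ennreal)

lemma enn_powr_mult: "enn_powr (x * y) p = enn_powr x p * enn_powr y p"
proof (cases "x = 0 \<or> y = 0")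
  case False
  then show ?thesis
    by (cases x; cases y)
       (auto simp: enn_powr_ennreal powr_mult ennreal_mult_top ennreal_top_mult simp flip: ennreal_mult)
qed auto

lemma enn_powr_enn_powr: "enn_powr (enn_powr x p) q = enn_powr x (p * q)"
  by (cases x) (auto simp: enn_powr_ennreal powr_powr)

lemma enn_powr_1 [simp]: "enn_powr x 1 = x"
  by (cases x) (auto simp: enn_powr_ennreal)

lemma measurable_enn_powr [measurable (raw)]:
  assumes [measurable]: "f \<in> borel_measurable M"
  shows "(\<lambda>x. enn_powr (f x) p) \<in> borel_measurable M"
  unfolding enn_powr_def by measurable

section \<open>Auerbach bases, resolvents and measurability of matrices\<close>

lemma matrix_inv_works:
  fixes A :: "'a::semiring_1 ^ 'n ^ 'm"
  assumes "invertible A"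
  shows matrix_inv_right: "A ** matrix_inv A = mat 1" and matrix_inv_left: "matrix_inv A ** A = mat 1"
  using someI_ex[OF assms[unfolded invertible_def]] by (simp_all add: matrix_inv_def)

text \<open>
  Among all matrices with rows in \<open>K\<close> choose one, \<open>V\<close>, with the largest \<open>\<bar>det V\<bar>\<close>.  By Cramer's rule
  the coefficient of \<open>w\<close> along the \<open>i\<close>-th row is the quotient of the determinant with that row
  replaced by \<open>w\<close> and \<open>det V\<close>; for \<open>w \<in> K\<close> maximality bounds it by 1.  The small ball
  inside \<open>K\<close> guarantees \<open>det V \<noteq> 0\<close>.
\<close>

lemma auerbach_basis:
  fixes K :: "(real ^ 'd) set"
  assumes K: "compact K" and r: "0 < r" "cball 0 r \<subseteq> K"
  obtains v u :: "'d \<Rightarrow> real ^ 'd"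
  where "\<And>i. v i \<in> K" "\<And>i w. w \<in> K \<Longrightarrow> \<bar>u i \<bullet> w\<bar> \<le> 1" "\<And>w. w = (\<Sum>i\<in>UNIV. (u i \<bullet> w) *\<^sub>R v i)"
proof -
  define S :: "(real ^ 'd ^ 'd) set" where "S = {V. \<forall>i. V $ i \<in> K}"
  have "compact S"
  proof -
    have "S = (\<Inter>i. (\<lambda>V. V $ i) -` K)" by (auto simp: S_def)
    moreover have "closed ((\<lambda>V. V $ i) -` K)" for i :: 'd
      using compact_imp_closed[OF K] by (intro continuous_closed_vimage continuous_intros) auto
    ultimately have "closed S" by auto
    moreover have "bounded S"
    proof -
      obtain R where R: "\<And>x. x \<in> K \<Longrightarrow> norm x \<le> R"
        using compact_imp_bounded[OF K] by (auto simp: bounded_iff)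
      have "norm V \<le> of_nat CARD('d) * R" if "V \<in> S" for V
      proof -
        have "norm V \<le> (\<Sum>i\<in>UNIV. norm (V $ i))" unfolding norm_vec_def by (rule L2_set_le_sum) auto
        also have "\<dots> \<le> (\<Sum>i\<in>(UNIV::'d set). R)" using that R by (intro sum_mono) (auto simp: S_def)
        finally show ?thesis by simp
      qed
      then show ?thesis by (auto simp: bounded_iff)
    qed
    ultimately show ?thesis by (simp add: compact_eq_bounded_closed)
  qed
  have cont: "continuous_on S (\<lambda>V. \<bar>det V\<bar>)"
    unfolding det_def by (intro continuous_intros)
  have diag: "mat r \<in> S"
  proof -
    have "norm ((mat r :: real ^ 'd ^ 'd) $ i) = r" for i
    proof -
      have "(mat r :: real ^ 'd ^ 'd) $ i = r *\<^sub>R axis i 1"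
        by (auto simp: vec_eq_iff mat_def axis_def)
      then show ?thesis using r by simp
    qed
    then show ?thesis using r(2) by (auto simp: S_def)
  qed
  then have "S \<noteq> {}" by auto
  then obtain V where V: "V \<in> S" and max: "\<And>V'. V' \<in> S \<Longrightarrow> \<bar>det V'\<bar> \<le> \<bar>det V\<bar>"
    using continuous_attains_sup[OF \<open>compact S\<close> _ cont] by blast
  have "\<bar>det (mat r :: real ^ 'd ^ 'd)\<bar> > 0"
    using r by (subst det_diagonal) (auto simp: mat_def)
  with max[OF diag] have dV: "det V \<noteq> 0" by auto
  let ?T = "transpose V"
  have dT: "det ?T \<noteq> 0" using dV by (simp add: det_transpose)
  then have inv: "?T ** matrix_inv ?T = mat 1"
    by (simp add: invertible_det_nz matrix_inv_right)
  define u where "u i = matrix_inv ?T $ i" for i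
  have coeff: "matrix_inv ?T *v w = (\<chi> i. u i \<bullet> w)" for w
    by (simp add: vec_eq_iff u_def matrix_vector_mul_component)
  have sol: "?T *v (matrix_inv ?T *v w) = w" for w
    by (simp add: matrix_vector_mul_assoc inv)
  show ?thesis
  proof
    show "V $ i \<in> K" for i using V by (auto simp: S_def)
    show "w = (\<Sum>i\<in>UNIV. (u i \<bullet> w) *\<^sub>R V $ i)" for w
      using sol[of w, symmetric] unfolding coeff unfolding matrix_mult_sum
      by (simp add: column_transpose row_def scalar_mult_eq_scaleR)
    show "\<bar>u i \<bullet> w\<bar> \<le> 1" if "w \<in> K" for i w
    proof -
      let ?V = "(\<chi> j. if j = i then w else V $ j) :: real ^ 'd ^ 'd"
      have "(u i \<bullet> w) = det (\<chi> a b. if b = i then w $ a else ?T $ a $ b) / det ?T"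
        using sol[of w] unfolding cramer[OF dT] coeff by (simp add: vec_eq_iff)
      also have "(\<chi> a b. if b = i then w $ a else ?T $ a $ b) = transpose ?V"
        by (auto simp: vec_eq_iff transpose_def)
      finally have "\<bar>u i \<bullet> w\<bar> = \<bar>det ?V\<bar> / \<bar>det V\<bar>" by (simp add: det_transpose)
      moreover have "?V \<in> S" using V that by (auto simp: S_def)
      ultimately show ?thesis using max[of ?V] dV by (simp add: divide_le_eq_1)
    qed
  qed
qed

text \<open>
  Everything follows from expanding \<open>\<bar>A h + \<epsilon> h\<bar>\<^sup>2 = \<bar>A h\<bar>\<^sup>2 + 2 \<epsilon> (A h) \<bullet> h + \<epsilon>\<^sup>2 \<bar>h\<bar>\<^sup>2\<close>, in which all
  terms are nonnegative.  The bound on \<open>A R\<close>, with \<open>R\<close> the resolvent, is uniform in \<open>\<epsilon>\<close>; the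
  one on \<open>R\<close> only serves to make test functions bounded.
\<close>

lemma psd_resolvent:
  fixes A :: "real ^ 'd ^ 'd"
  assumes sym: "transpose A = A" and psd: "\<And>v. 0 \<le> (A *v v) \<bullet> v" and \<epsilon>: "0 < \<epsilon>"
  defines "R \<equiv> matrix_inv (A + mat \<epsilon>)"
  shows "det (A + mat \<epsilon>) \<noteq> 0"
    and "A *v (R *v u) + \<epsilon> *\<^sub>R (R *v u) = u"
    and "norm (R *v u) \<le> norm u / \<epsilon>"
    and "norm (A *v (R *v u)) \<le> norm u"
    and "u \<bullet> (R *v w) = (R *v u) \<bullet> w"
proof -
  have mat: "mat \<epsilon> *v h = \<epsilon> *\<^sub>R h" for h :: "real ^ 'd"
    by (simp add: vec_eq_iff matrix_vector_mult_def mat_def if_distrib[of "\<lambda>x. x * _"] cong: if_cong)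
  have bound: "norm h \<le> norm k / \<epsilon>" "norm (A *v h) \<le> norm k" if "A *v h + \<epsilon> *\<^sub>R h = k" for h k
  proof -
    have "(norm k)\<^sup>2 = (norm (A *v h))\<^sup>2 + 2 * \<epsilon> * ((A *v h) \<bullet> h) + (\<epsilon> * norm h)\<^sup>2"
      unfolding that[symmetric]
      by (simp add: power2_norm_eq_inner inner_add inner_commute power_mult_distrib algebra_simps power2_eq_square[of \<epsilon>])
    moreover have "0 \<le> 2 * \<epsilon> * ((A *v h) \<bullet> h)" using psd \<epsilon> by simp
    ultimately have "(norm (A *v h))\<^sup>2 \<le> (norm k)\<^sup>2" "(\<epsilon> * norm h)\<^sup>2 \<le> (norm k)\<^sup>2" by (simp_all add: add_nonneg_nonneg)
    then have "norm (A *v h) \<le> norm k" "\<epsilon> * norm h \<le> norm k"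
      by (meson norm_ge_zero power2_le_imp_le)+
    then show "norm h \<le> norm k / \<epsilon>" "norm (A *v h) \<le> norm k" using \<epsilon> by (simp_all add: field_simps)
  qed
  have "invertible (A + mat \<epsilon>)"
    unfolding invertible_left_inverse matrix_left_invertible_ker
  proof (intro allI impI)
    fix h :: "real ^ 'd" assume "(A + mat \<epsilon>) *v h = 0"
    then have "A *v h + \<epsilon> *\<^sub>R h = 0" by (simp only: matrix_vector_mult_add_rdistrib mat)
    from bound(1)[OF this] show "h = 0" by simp
  qed
  then show "det (A + mat \<epsilon>) \<noteq> 0" by (simp add: invertible_det_nz)
  have R: "A *v (R *v k) + \<epsilon> *\<^sub>R (R *v k) = k" for k
  proof -
    have "(A + mat \<epsilon>) *v (R *v k) = k"
      using \<open>invertible (A + mat \<epsilon>)\<close> by (simp add: matrix_vector_mul_assoc R_def matrix_inv_right)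
    then show ?thesis by (simp only: matrix_vector_mult_add_rdistrib mat)
  qed
  show "A *v (R *v u) + \<epsilon> *\<^sub>R (R *v u) = u" by (rule R)
  show "norm (R *v u) \<le> norm u / \<epsilon>" "norm (A *v (R *v u)) \<le> norm u"
    using bound[OF R] .
  have self: "(A *v h) \<bullet> k = h \<bullet> (A *v k)" for h k
    by (metis dot_lmul_matrix sym vector_transpose_matrix)
  have "u \<bullet> (R *v w) = (A *v (R *v u) + \<epsilon> *\<^sub>R (R *v u)) \<bullet> (R *v w)" by (simp only: R)
  also have "\<dots> = (R *v u) \<bullet> (A *v (R *v w) + \<epsilon> *\<^sub>R (R *v w))" by (simp add: inner_add self)
  also have "\<dots> = (R *v u) \<bullet> w" by (simp only: R)
  finally show "u \<bullet> (R *v w) = (R *v u) \<bullet> w" .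
qed

lemma borel_measurable_vecI:
  fixes f :: "'a \<Rightarrow> 'b::euclidean_space ^ 'd"
  assumes "\<And>i. (\<lambda>x. f x $ i) \<in> borel_measurable M"
  shows "f \<in> borel_measurable M"
  using assms by (subst borel_measurable_euclidean_space) (auto simp: Basis_vec_def inner_axis)

lemma borel_measurable_vec_nth [measurable (raw)]:
  fixes f :: "'a \<Rightarrow> 'b::real_normed_vector ^ 'd"
  assumes "f \<in> borel_measurable M"
  shows "(\<lambda>x. f x $ i) \<in> borel_measurable M"
  by (rule borel_measurable_continuous_on[OF _ assms]) (intro continuous_intros)

lemma borel_measurable_matrix_vector_mult [measurable (raw)]:
  fixes A :: "'a \<Rightarrow> real ^ 'd ^ 'c"
  assumes [measurable]: "\<And>i j. (\<lambda>x. A x $ i $ j) \<in> borel_measurable M" "f \<in> borel_measurable M"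
  shows "(\<lambda>x. A x *v f x) \<in> borel_measurable M"
  by (rule borel_measurable_vecI) (simp add: matrix_vector_mult_def)

text \<open>
  Measurability is read off from Cramer's rule, which writes each component of the solution as a
  quotient of determinants.
\<close>

lemma borel_measurable_matrix_inv_mult:
  fixes A :: "'a \<Rightarrow> real ^ 'd ^ 'd"
  assumes [measurable]: "\<And>i j. (\<lambda>x. A x $ i $ j) \<in> borel_measurable M" "f \<in> borel_measurable M"
    and inv: "\<And>x. x \<in> space M \<Longrightarrow> det (A x) \<noteq> 0"
  shows "(\<lambda>x. matrix_inv (A x) *v f x) \<in> borel_measurable M"
proof (rule borel_measurable_vecI)
  fix k
  have "(\<lambda>x. det (\<chi> i j. if j = k then f x $ i else A x $ i $ j) / det (A x)) \<in> borel_measurable M"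
    unfolding det_def
    by (simp add: if_distrib[of "\<lambda>f. f _"]) measurable
  also have "?this \<longleftrightarrow> (\<lambda>x. (matrix_inv (A x) *v f x) $ k) \<in> borel_measurable M"
  proof (rule measurable_cong)
    fix x assume "x \<in> space M"
    then have d: "det (A x) \<noteq> 0" using inv by auto
    then have "A x *v (matrix_inv (A x) *v f x) = f x"
      by (simp add: matrix_vector_mul_assoc invertible_det_nz matrix_inv_right)
    then show "det (\<chi> i j. if j = k then f x $ i else A x $ i $ j) / det (A x) = (matrix_inv (A x) *v f x) $ k"
      unfolding cramer[OF d] by (simp add: vec_eq_iff)
  qed
  finally show "(\<lambda>x. (matrix_inv (A x) *v f x) $ k) \<in> borel_measurable M" .
qed

section \<open>Duality for weights with bounded averaging\<close>

lemma conjugate_exponents: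
  fixes p p' :: real
  assumes "1 < p" "1 / p + 1 / p' = 1"
  shows "1 < p'" "(p' - 1) * p = p'" "(p - 1) * p' = p" "0 < p" "0 < p'"
proof -
  have "1 / p' = (p - 1) / p" using assms by (simp add: field_simps)
  then have eq: "p' = p / (p - 1)" using assms(1) by (metis inverse_divide inverse_eq_divide inverse_inverse_eq)
  show "1 < p'" "0 < p'" using assms(1) unfolding eq by (simp_all add: field_simps)
  have "p' - 1 = 1 / (p - 1)" using assms(1) unfolding eq by (simp add: field_simps)
  then show "(p' - 1) * p = p'" using eq by simp
  show "(p - 1) * p' = p" "0 < p" using assms(1) unfolding eq by simp_all
qed

lemma powr_sum_le:
  fixes a :: "'i \<Rightarrow> real"
  assumes "finite I" "I \<noteq> {}" "\<And>i. i \<in> I \<Longrightarrow> 0 \<le> a i" "0 \<le> p"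
  shows "(\<Sum>i\<in>I. a i) powr p \<le> real (card I) powr p * (\<Sum>i\<in>I. a i powr p)"
proof -
  obtain j where j: "j \<in> I" "\<And>i. i \<in> I \<Longrightarrow> a i \<le> a j"
    using finite_has_maximal[of "a ` I"] assms
    by (metis (no_types, lifting) Max_ge Max_in finite_imageI image_iff image_is_empty)
  have "(\<Sum>i\<in>I. a i) \<le> real (card I) * a j" using j by (intro sum_bounded_above) auto
  then have "(\<Sum>i\<in>I. a i) powr p \<le> (real (card I) * a j) powr p"
    using assms by (intro powr_mono2 sum_nonneg) auto
  also have "\<dots> = real (card I) powr p * a j powr p" by (rule powr_mult)
  also have "a j powr p \<le> (\<Sum>i\<in>I. a i powr p)"
    using j assms by (intro member_le_sum) auto
  finally show ?thesis by (simp add: mult_left_mono)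
qed

text \<open>
  This is the situation on one basis set, with \<open>M\<close> the normalised Lebesgue measure on it and \<open>A\<close> a
  finite version of the weight: averaging \<open>f \<mapsto> \<integral> f\<close> is bounded by \<open>C\<close> on the weighted
  \<open>L\<^sup>p\<close> space.  The restriction to bounded \<open>f\<close> keeps \<open>\<integral> f\<close> meaningful.
\<close>

locale averaging_bounded_weight = finite_measure M
  for M :: "'a measure" +
  fixes A :: "'a \<Rightarrow> real ^ 'd ^ 'd" and p p' C :: real
  assumes A_measurable [measurable]: "\<And>i j. (\<lambda>x. A x $ i $ j) \<in> borel_measurable M"
    and sym: "\<And>x. transpose (A x) = A x"
    and psd: "\<And>x v. 0 \<le> (A x *v v) \<bullet> v"
    and p: "1 < p" and p': "1 / p + 1 / p' = 1" and C: "0 < C"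
    and norm_finite: "\<And>v. (\<integral>\<^sup>+x. ennreal (norm (A x *v v) powr p) \<partial>M) < \<infinity>"
    and norm_definite: "\<And>v. (AE x in M. A x *v v = 0) \<Longrightarrow> v = 0"
    and averaging: "\<And>f R. f \<in> borel_measurable M \<Longrightarrow> (\<And>x. norm (f x) \<le> R) \<Longrightarrow>
      (\<integral>\<^sup>+x. ennreal (norm (A x *v (\<integral>y. f y \<partial>M)) powr p) \<partial>M)
        \<le> ennreal (C powr p) * (\<integral>\<^sup>+x. ennreal (norm (A x *v f x) powr p) \<partial>M)"
begin

text \<open>
  The \<open>p\<close>-th power of the norm on vectors induced by the weight.
\<close>

definition N :: "real ^ 'd \<Rightarrow> real" where
  "N v = (\<integral>x. norm (A x *v v) powr p \<partial>M)"

lemma exponents: "1 < p'" "(p' - 1) * p = p'" "(p - 1) * p' = p" "0 < p" "0 < p'"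
  using conjugate_exponents[OF p p'] .

lemma integrable_N: "integrable M (\<lambda>x. norm (A x *v v) powr p)"
  using norm_finite[of v] by (intro integrableI_bounded) auto

lemma nn_integral_N: "(\<integral>\<^sup>+x. ennreal (norm (A x *v v) powr p) \<partial>M) = ennreal (N v)"
  unfolding N_def by (intro nn_integral_eq_integral integrable_N) auto

lemma N_nonneg: "0 \<le> N v"
  unfolding N_def by (intro integral_nonneg_AE) auto

lemma N_scale: "N (c *\<^sub>R v) = \<bar>c\<bar> powr p * N v"
  by (simp add: N_def matrix_vector_mult_scaleR powr_mult)

lemma N_pos: "v \<noteq> 0 \<Longrightarrow> 0 < N v"
proof -
  assume "v \<noteq> 0"
  have "N v \<noteq> 0"
  proof
    assume "N v = 0"
    then have "AE x in M. norm (A x *v v) powr p = 0"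
      unfolding N_def using integrable_N by (subst (asm) integral_nonneg_eq_0_iff_AE) auto
    then have "AE x in M. A x *v v = 0" by (rule AE_mp) (auto)
    with \<open>v \<noteq> 0\<close> show False using norm_definite by blast
  qed
  with N_nonneg[of v] show ?thesis by simp
qed

lemma norm_mult_vec_le: "norm (A x *v v) \<le> (\<Sum>i\<in>UNIV. norm (A x *v axis i 1)) * norm v"
proof -
  have "A x *v v = (\<Sum>i\<in>UNIV. (v $ i) *\<^sub>R (A x *v axis i 1))"
    unfolding matrix_vector_mult_basis by (simp add: matrix_mult_sum scalar_mult_eq_scaleR)
  also have "norm \<dots> \<le> (\<Sum>i\<in>UNIV. \<bar>v $ i\<bar> * norm (A x *v axis i 1))"
    by (rule sum_norm_le) simp
  also have "\<dots> \<le> (\<Sum>i\<in>UNIV. norm v * norm (A x *v axis i 1))"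
    by (intro sum_mono mult_right_mono component_le_norm_cart) auto
  finally show ?thesis by (simp add: sum_distrib_left mult.commute)
qed

text \<open>
  Dominated convergence: on a ball of radius \<open>R\<close> all integrands lie below a multiple of the sum of the
  integrands belonging to the coordinate vectors.
\<close>

lemma continuous_N: "continuous_on UNIV N"
  unfolding continuous_on_sequentially comp_def
proof (intro ballI allI impI, elim conjE)
  fix v :: "real ^ 'd" and w assume lim: "w \<longlonglongrightarrow> v"
  then obtain R where R: "0 < R" "\<And>n. norm (w n) \<le> R"
    using convergent_imp_Bseq[of w] by (auto simp: convergent_def Bseq_def)
  let ?T = "\<lambda>x. \<Sum>i\<in>UNIV. norm (A x *v axis i 1)"
  have "integrable M (\<lambda>x. R powr p * (real CARD('d) powr p * (\<Sum>i\<in>UNIV. norm (A x *v axis i 1) powr p)))"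
    by (intro integrable_mult_right Bochner_Integration.integrable_sum integrable_N)
  then show "(\<lambda>n. N (w n)) \<longlonglongrightarrow> N v"
    unfolding N_def
  proof (rule integral_dominated_convergence[rotated 2])
    show "AE x in M. (\<lambda>n. norm (A x *v w n) powr p) \<longlonglongrightarrow> norm (A x *v v) powr p"
    proof (intro AE_I2 tendsto_powr2 tendsto_norm)
      show "(\<lambda>n. A x *v w n) \<longlonglongrightarrow> A x *v v" for x
        using lim by (rule bounded_linear.tendsto[OF matrix_vector_mul_bounded_linear])
    qed (use p in auto)
    show "AE x in M. norm (norm (A x *v w n) powr p) \<le>
        R powr p * (real CARD('d) powr p * (\<Sum>i\<in>UNIV. norm (A x *v axis i 1) powr p))" for n
    proof (intro AE_I2)
      fix x
      have "norm (A x *v w n) powr p \<le> (R * ?T x) powr p"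
      proof (intro powr_mono2)
        have "norm (A x *v w n) \<le> ?T x * norm (w n)" by (rule norm_mult_vec_le)
        also have "\<dots> \<le> ?T x * R" by (intro mult_left_mono R sum_nonneg) auto
        finally show "norm (A x *v w n) \<le> R * ?T x" by (simp add: mult.commute)
      qed (use p in auto)
      also have "\<dots> = R powr p * ?T x powr p" by (rule powr_mult)
      also have "\<dots> \<le> R powr p * (real CARD('d) powr p * (\<Sum>i\<in>UNIV. norm (A x *v axis i 1) powr p))"
        using p by (intro mult_left_mono powr_sum_le) auto
      finally show "norm (norm (A x *v w n) powr p) \<le>
        R powr p * (real CARD('d) powr p * (\<Sum>i\<in>UNIV. norm (A x *v axis i 1) powr p))" by simp
    qed
  qed measurable
qed

text \<open>
  By homogeneity it suffices that \<open>N\<close> has a positive minimum and a finite maximum on the unit sphere.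
\<close>

lemma compact_unit_ball: "compact {v. N v \<le> 1}"
  and ball_subset_unit_ball: "\<exists>r>0. cball 0 r \<subseteq> {v. N v \<le> 1}"
proof -
  have scale: "N v = norm v powr p * N (v /\<^sub>R norm v)" if "v \<noteq> 0" for v
    using N_scale[of "norm v" "v /\<^sub>R norm v"] that by simp
  have sph: "compact (sphere (0 :: real ^ 'd) 1)" "sphere (0 :: real ^ 'd) 1 \<noteq> {}" by auto
  have cont: "continuous_on (sphere 0 1) N" using continuous_N by (rule continuous_on_subset) auto
  obtain a where a: "a \<in> sphere 0 1" "\<And>v. v \<in> sphere 0 1 \<Longrightarrow> N a \<le> N v"
    using continuous_attains_inf[OF sph cont] by blast
  obtain b where b: "b \<in> sphere 0 1" "\<And>v. v \<in> sphere 0 1 \<Longrightarrow> N v \<le> N b"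
    using continuous_attains_sup[OF sph cont] by blast
  have Na: "0 < N a" and Nb: "0 < N b" using a(1) b(1) by (auto intro!: N_pos)
  have p0: "0 < p" using p by simp
  have "norm v \<le> (1 / N a) powr (1 / p)" if "N v \<le> 1" for v
  proof (cases "v = 0")
    case False
    have "norm v powr p * N a \<le> norm v powr p * N (v /\<^sub>R norm v)"
      using False by (intro mult_left_mono a) auto
    also have "\<dots> \<le> 1" using scale[OF False] that by simp
    finally have "norm v powr p \<le> 1 / N a" using Na by (simp add: field_simps)
    then have "(norm v powr p) powr (1 / p) \<le> (1 / N a) powr (1 / p)" using p0 by (intro powr_mono2) auto
    then show ?thesis using p0 by (simp add: powr_powr)
  qed auto
  then have "bounded {v. N v \<le> 1}" by (auto simp: bounded_iff)
  moreover have "closed {v. N v \<le> 1}"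
    by (intro closed_Collect_le continuous_N continuous_intros)
  ultimately show "compact {v. N v \<le> 1}" by (simp add: compact_eq_bounded_closed)
  have "N v \<le> 1" if "norm v \<le> (1 / N b) powr (1 / p)" for v
  proof (cases "v = 0")
    case True
    then show ?thesis by (simp add: N_def)
  next
    case False
    have "norm v powr p \<le> ((1 / N b) powr (1 / p)) powr p" using that p0 by (intro powr_mono2) auto
    also have "\<dots> = 1 / N b" using p0 Nb by (simp add: powr_powr)
    finally have *: "norm v powr p * N b \<le> 1" using Nb by (simp add: field_simps)
    have "N v \<le> norm v powr p * N b"
      unfolding scale[OF False] using False by (intro mult_left_mono b) auto
    with * show ?thesis by simp
  qed
  then show "\<exists>r>0. cball 0 r \<subseteq> {v. N v \<le> 1}"
    using Nb by (intro exI[of _ "(1 / N b) powr (1 / p)"]) auto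
qed

text \<open>
  This is the equality case of Hoelder's inequality.  With \<open>R = (A + \<epsilon>)\<^sup>-\<^sup>1\<close> and \<open>h = R u\<close>, the
  function \<open>g = (\<bar>h\<bar> powr (p' - 2)) h\<close> is dual to \<open>h\<close>, and \<open>f = R g\<close> is tested against averaging.  As \<open>R\<close> is
  symmetric, \<open>u \<bullet> \<integral> f = \<integral> h \<bullet> g\<close> is the integral \<open>I\<close> to be estimated; as \<open>A R\<close> is a contraction, the
  weighted norm of \<open>f\<close> is controlled by \<open>I\<close> as well.  So \<open>I\<^sup>p \<le> C\<^sup>p I\<close>, and \<open>I\<close> can be cancelled
  because the resolvent makes it finite.
\<close>

lemma dual_estimate_resolvent:
  assumes u: "\<And>w. N w \<le> 1 \<Longrightarrow> \<bar>u \<bullet> w\<bar> \<le> 1" and \<epsilon>: "0 < \<epsilon>"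
  shows "(\<integral>\<^sup>+x. ennreal (norm (matrix_inv (A x + mat \<epsilon>) *v u) powr p') \<partial>M) \<le> ennreal (C powr p')"
proof -
  have u_le: "\<bar>u \<bullet> w\<bar> powr p \<le> N w" for w
  proof (cases "w = 0")
    case False
    \<comment> \<open>\<open>c\<close> is the norm of \<open>w\<close>, so that \<open>w / c\<close> lies on the unit sphere.\<close>
    define c where "c = N w powr (1 / p)"
    have c: "0 < c" "c powr p = N w" using N_pos[OF False] exponents by (auto simp: c_def powr_powr)
    then have "N (w /\<^sub>R c) = 1" using N_pos[OF False] by (simp add: N_scale powr_divide powr_one_eq_one inverse_eq_divide)
    from u[of "w /\<^sub>R c"] this have "\<bar>u \<bullet> w\<bar> / c \<le> 1" using c by (simp add: abs_mult divide_inverse mult.commute)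
    then have "\<bar>u \<bullet> w\<bar> powr p \<le> c powr p" using c exponents by (intro powr_mono2) (auto simp: field_simps)
    with c show ?thesis by simp
  qed (simp add: N_nonneg)
  define R where "R x = matrix_inv (A x + mat \<epsilon>)" for x
  define h where "h x = R x *v u" for x
  define f where "f x = (norm (h x) powr (p' - 2)) *\<^sub>R (R x *v h x)" for x
  note res = psd_resolvent[OF sym psd \<epsilon>, folded R_def]
  have h_meas [measurable]: "h \<in> borel_measurable M"
    unfolding h_def R_def
  proof (rule borel_measurable_matrix_inv_mult)
    show "(\<lambda>x. (A x + mat \<epsilon>) $ i $ j) \<in> borel_measurable M" for i j by simp
  qed (use res(1) in auto)
  have [measurable]: "(\<lambda>x. R x *v h x) \<in> borel_measurable M"
    unfolding R_def
  proof (rule borel_measurable_matrix_inv_mult)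
    show "(\<lambda>x. (A x + mat \<epsilon>) $ i $ j) \<in> borel_measurable M" for i j by simp
  qed (use res(1) in auto)
  have f_meas [measurable]: "f \<in> borel_measurable M" unfolding f_def by measurable
  have h_bound: "norm (h x) \<le> norm u / \<epsilon>" for x unfolding h_def by (rule res)
  have mult: "norm (h x) powr (p' - 2) * norm (h x) = norm (h x) powr (p' - 1)" for x
    using powr_add[of "norm (h x)" "p' - 2" 1] by simp
  have f_bound: "norm (f x) \<le> (norm u / \<epsilon>) powr (p' - 1) / \<epsilon>" for x
  proof -
    have "norm (f x) \<le> norm (h x) powr (p' - 2) * (norm (h x) / \<epsilon>)"
      using mult_left_mono[OF res(3)[of x "h x"], of "norm (h x) powr (p' - 2)"] by (simp add: f_def)
    also have "\<dots> = norm (h x) powr (p' - 1) / \<epsilon>" using mult[of x] by simp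
    also have "\<dots> \<le> (norm u / \<epsilon>) powr (p' - 1) / \<epsilon>"
      using h_bound exponents \<epsilon> by (intro divide_right_mono powr_mono2) auto
    finally show ?thesis .
  qed
  have f_int: "integrable M f"
    using f_bound by (intro integrable_const_bound) auto
  have h_int: "integrable M (\<lambda>x. norm (h x) powr p')"
  proof (rule integrable_const_bound)
    show "AE x in M. norm (norm (h x) powr p') \<le> (norm u / \<epsilon>) powr p'"
      using h_bound exponents by (auto intro!: powr_mono2)
  qed measurable
  define I where "I = (\<integral>x. norm (h x) powr p' \<partial>M)"
  have I: "(\<integral>\<^sup>+x. ennreal (norm (h x) powr p') \<partial>M) = ennreal I" "0 \<le> I"
    unfolding I_def by (auto intro!: nn_integral_eq_integral h_int integral_nonneg_AE)
  have "u \<bullet> (\<integral>x. f x \<partial>M) = (\<integral>x. u \<bullet> f x \<partial>M)"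
    using f_int by simp
  also have "\<dots> = I"
    unfolding I_def
  proof (rule Bochner_Integration.integral_cong)
    fix x
    have "u \<bullet> f x = norm (h x) powr (p' - 2) * (h x \<bullet> h x)"
      by (simp add: f_def res(5)) (simp add: h_def)
    also have "\<dots> = norm (h x) powr (p' - 1) * norm (h x)"
      using mult[of x] by (simp add: dot_square_norm power2_eq_square)
    also have "\<dots> = norm (h x) powr p'"
      using powr_add[of "norm (h x)" "p' - 1" 1] by simp
    finally show "u \<bullet> f x = norm (h x) powr p'" .
  qed simp
  finally have uf: "u \<bullet> (\<integral>x. f x \<partial>M) = I" .
  have Af: "norm (A x *v f x) powr p \<le> norm (h x) powr p'" for x
  proof -
    have "norm (A x *v f x) \<le> norm (h x) powr (p' - 2) * norm (h x)"
      using mult_left_mono[OF res(4)[of x "h x"], of "norm (h x) powr (p' - 2)"]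
      by (simp add: f_def matrix_vector_mult_scaleR)
    then have "norm (A x *v f x) powr p \<le> (norm (h x) powr (p' - 1)) powr p"
      using exponents mult[of x] by (intro powr_mono2) auto
    then show ?thesis by (simp add: powr_powr exponents)
  qed
  have "ennreal (I powr p) \<le> ennreal (N (\<integral>x. f x \<partial>M))"
    using u_le[of "\<integral>x. f x \<partial>M"] I(2) by (intro ennreal_leI) (simp add: uf)
  also have "\<dots> \<le> ennreal (C powr p) * (\<integral>\<^sup>+x. ennreal (norm (A x *v f x) powr p) \<partial>M)"
    unfolding nn_integral_N[symmetric] by (rule averaging[OF f_meas f_bound])
  also have "\<dots> \<le> ennreal (C powr p) * (\<integral>\<^sup>+x. ennreal (norm (h x) powr p') \<partial>M)"
    by (intro mult_left_mono nn_integral_mono ennreal_leI Af) auto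
  also have "\<dots> = ennreal (C powr p * I)" unfolding I by (simp add: ennreal_mult I)
  finally have main: "I powr p \<le> C powr p * I" using I(2) by simp
  have "I \<le> C powr p'"
  proof (cases "I = 0")
    case False
    with I have "0 < I" by simp
    then have "I powr (p - 1) \<le> C powr p" using main by (simp add: powr_diff field_simps)
    then have "(I powr (p - 1)) powr (1 / (p - 1)) \<le> (C powr p) powr (1 / (p - 1))"
      using p by (intro powr_mono2) auto
    moreover have "p / (p - 1) = p'" using exponents p by (simp add: field_simps)
    ultimately show ?thesis using p \<open>0 < I\<close> by (simp add: powr_powr)
  qed auto
  then show ?thesis using I unfolding h_def R_def by (simp add: ennreal_leI)
qed

text \<open>
  Comparing the inverse with this limit inferior, instead of passing to the limit, needs no continuity of
  the inverse, and the value is meaningful where \<open>A x\<close> is singular.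
\<close>

definition resolvent_liminf :: "real ^ 'd \<Rightarrow> 'a \<Rightarrow> ennreal" where
  "resolvent_liminf u x =
     liminf (\<lambda>n. ennreal (norm (matrix_inv (A x + mat (1 / Suc n)) *v u) powr p'))"

lemma measurable_resolvent:
  assumes "0 < \<epsilon>" shows "(\<lambda>x. matrix_inv (A x + mat \<epsilon>) *v u) \<in> borel_measurable M"
proof (rule borel_measurable_matrix_inv_mult)
  show "(\<lambda>x. (A x + mat \<epsilon>) $ i $ j) \<in> borel_measurable M" for i j by simp
qed (use psd_resolvent(1)[OF sym psd assms] in auto)

lemma measurable_resolvent_liminf [measurable]: "resolvent_liminf u \<in> borel_measurable M"
proof -
  have [measurable]: "(\<lambda>x. matrix_inv (A x + mat (1 / Suc n)) *v u) \<in> borel_measurable M" for n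
    by (rule measurable_resolvent) simp
  show ?thesis unfolding resolvent_liminf_def[abs_def] by measurable
qed

lemma resolvent_liminf_integral:
  assumes u: "\<And>w. N w \<le> 1 \<Longrightarrow> \<bar>u \<bullet> w\<bar> \<le> 1"
  shows "(\<integral>\<^sup>+x. resolvent_liminf u x \<partial>M) \<le> ennreal (C powr p')"
proof -
  have [measurable]: "(\<lambda>x. matrix_inv (A x + mat (1 / Suc n)) *v u) \<in> borel_measurable M" for n
    by (rule measurable_resolvent) simp
  have "(\<integral>\<^sup>+x. resolvent_liminf u x \<partial>M) \<le>
      liminf (\<lambda>n. \<integral>\<^sup>+x. ennreal (norm (matrix_inv (A x + mat (1 / Suc n)) *v u) powr p') \<partial>M)"
    unfolding resolvent_liminf_def by (intro nn_integral_liminf) measurable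
  also have "\<dots> \<le> liminf (\<lambda>n. ennreal (C powr p'))"
    by (intro Liminf_mono always_eventually allI dual_estimate_resolvent[OF u]) auto
  finally show ?thesis by (simp add: Liminf_const)
qed

text \<open>
  Pairing \<open>(A + \<epsilon>) h = u\<close> with a kernel vector \<open>w\<close> gives \<open>u \<bullet> w = \<epsilon> h \<bullet> w\<close>, so \<open>\<bar>h\<bar>\<close> grows at least like
  \<open>1 / \<epsilon>\<close>.
\<close>

lemma resolvent_liminf_kernel:
  assumes w: "A x *v w = 0" and uw: "u \<bullet> w \<noteq> 0"
  shows "resolvent_liminf u x = top"
proof -
  have "w \<noteq> 0" using uw by auto
  define c where "c = \<bar>u \<bullet> w\<bar> / norm w"
  have c: "0 < c" using uw \<open>w \<noteq> 0\<close> by (simp add: c_def)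
  have lower: "real (Suc n) * c \<le> norm (matrix_inv (A x + mat (1 / Suc n)) *v u)" for n
  proof -
    let ?e = "1 / real (Suc n)" let ?R = "matrix_inv (A x + mat ?e)"
    have "(A x *v h) \<bullet> w = 0" for h
      by (metis dot_lmul_matrix inner_zero_right sym vector_transpose_matrix w)
    then have "u \<bullet> w = ?e * ((?R *v u) \<bullet> w)"
      by (subst psd_resolvent(2)[OF sym psd, of ?e x u, symmetric]) (auto simp: inner_add)
    then have "\<bar>u \<bullet> w\<bar> = ?e * \<bar>(?R *v u) \<bullet> w\<bar>" by (simp add: abs_mult)
    also have "\<dots> \<le> ?e * (norm (?R *v u) * norm w)"
      by (intro mult_left_mono Cauchy_Schwarz_ineq2) auto
    finally show ?thesis using \<open>w \<noteq> 0\<close> by (simp add: c_def field_simps)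
  qed
  have "ennreal K \<le> resolvent_liminf u x" for K
    unfolding resolvent_liminf_def
  proof (intro Liminf_bounded eventually_sequentiallyI ennreal_leI)
    fix n assume "nat \<lceil>max K 1 / c\<rceil> \<le> n"
    then have "max K 1 / c \<le> real (Suc n)" by linarith
    then have K: "max K 1 \<le> norm (matrix_inv (A x + mat (1 / Suc n)) *v u)" (is "_ \<le> ?h")
      using lower[of n] c by (simp only: pos_divide_le_eq)
    then have "?h powr 1 \<le> ?h powr p'" using exponents by (intro powr_mono) auto
    then show "K \<le> ?h powr p'" using K by simp
  qed
  then show ?thesis
    by (cases "resolvent_liminf u x") (auto, metis add.commute ennreal_le_iff2 less_add_one not_less add_nonneg_nonneg zero_le_one)
qed

text \<open>
  Applying the inverse to \<open>A h + \<epsilon> h = u\<close> gives \<open>A\<^sup>-\<^sup>1 u = h + \<epsilon> A\<^sup>-\<^sup>1 h\<close>, which has norm at most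
  \<open>2 \<bar>h\<bar>\<close> once \<open>\<epsilon>\<close> times the norm of \<open>A\<^sup>-\<^sup>1\<close> is at most 1.  The factor 2 avoids a limit argument.
\<close>

lemma inverse_le_resolvent_liminf:
  assumes "invertible (A x)"
  shows "ennreal (norm (matrix_inv (A x) *v u) powr p') \<le> ennreal (2 powr p') * resolvent_liminf u x"
proof -
  let ?I = "matrix_inv (A x)"
  obtain B where B: "0 < B" "\<And>z. norm (?I *v z) \<le> norm z * B"
    using bounded_linear.pos_bounded[OF matrix_vector_mul_bounded_linear[of ?I]] by auto
  have "ennreal (norm ((1/2) *\<^sub>R (?I *v u)) powr p') \<le> resolvent_liminf u x"
    unfolding resolvent_liminf_def
  proof (intro Liminf_bounded eventually_sequentiallyI ennreal_leI powr_mono2)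
    fix n assume "nat \<lceil>B\<rceil> \<le> n"
    then have n: "B \<le> real (Suc n)" by linarith
    let ?e = "1 / real (Suc n)" let ?h = "matrix_inv (A x + mat ?e) *v u"
    have cancel: "?I *v (A x *v k) = k" for k
      using assms by (simp add: matrix_vector_mul_assoc matrix_inv_left)
    have "?I *v u = ?I *v (A x *v ?h + ?e *\<^sub>R ?h)"
      by (subst psd_resolvent(2)[OF sym psd]) auto
    also have "\<dots> = ?h + ?e *\<^sub>R (?I *v ?h)"
      by (simp only: matrix_vector_right_distrib cancel matrix_vector_mult_scaleR)
    finally have "norm (?I *v u) \<le> norm ?h + ?e * norm (?I *v ?h)"
      using norm_triangle_ineq[of ?h "?e *\<^sub>R (?I *v ?h)"] by simp
    also have "\<dots> \<le> norm ?h + ?e * (norm ?h * B)" by (intro add_left_mono mult_left_mono B) auto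
    also have "\<dots> \<le> norm ?h + norm ?h * 1"
      using n mult_left_mono[OF n, of "norm ?h"] by (simp add: field_simps)
    finally show "norm ((1/2) *\<^sub>R (?I *v u)) \<le> norm ?h" by simp
  qed (use exponents in auto)
  then have "ennreal (2 powr p') * ennreal (norm ((1/2) *\<^sub>R (?I *v u)) powr p') \<le> ennreal (2 powr p') * resolvent_liminf u x"
    by (rule mult_left_mono) simp
  moreover have "2 powr p' * norm ((1/2) *\<^sub>R (?I *v u)) powr p' = norm (?I *v u) powr p'"
    by (simp add: powr_divide)
  ultimately show ?thesis by (simp flip: ennreal_mult)
qed

text \<open>
  \<open>S\<close> sums \<open>\<bar>A v\<^sub>i\<bar>\<close> over an Auerbach basis \<open>v\<^sub>i\<close> of the unit ball of \<open>N\<close>, and \<open>T\<close> sums \<open>\<bar>A\<^sup>-\<^sup>1 u\<^sub>i\<bar>\<close> over the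
  dual basis.  Their integrals are bounded by constants that depend on \<open>d\<close>, \<open>p\<close> and \<open>C\<close> alone, whereas
  \<open>K'\<close> and \<open>K\<close> depend on the weight; they enter qualitative statements only.
\<close>

lemma kernel_factorization:
  obtains S T :: "'a \<Rightarrow> real" and K' K :: real
  where "S \<in> borel_measurable M" "T \<in> borel_measurable M" "\<And>x. 0 \<le> S x" "\<And>x. 0 \<le> T x"
    and "(\<integral>\<^sup>+x. ennreal (S x powr p) \<partial>M) \<le> ennreal (real CARD('d) powr (p + 1))"
    and "(\<integral>\<^sup>+x. ennreal (T x powr p') \<partial>M) \<le> ennreal (real CARD('d) powr (p' + 1) * (2 * C) powr p')"
    and "\<And>x z. norm (A x *v z) \<le> K' * S x * norm z"
    and "AE y in M. invertible (A y) \<and>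
      (\<forall>z. norm (matrix_inv (A y) *v z) \<le> K * T y * norm z) \<and>
      (\<forall>x z. norm (A x *v (matrix_inv (A y) *v z)) \<le> S x * T y * norm z)"
proof -
  obtain v u :: "'d \<Rightarrow> real ^ 'd" where v: "\<And>i. N (v i) \<le> 1"
    and u: "\<And>i w. N w \<le> 1 \<Longrightarrow> \<bar>u i \<bullet> w\<bar> \<le> 1"
    and dec: "\<And>w. w = (\<Sum>i\<in>UNIV. (u i \<bullet> w) *\<^sub>R v i)"
  proof -
    obtain r where "0 < r" "cball 0 r \<subseteq> {v. N v \<le> 1}" using ball_subset_unit_ball by blast
    from auerbach_basis[OF compact_unit_ball this] that show ?thesis by auto
  qed
  have "AE x in M. resolvent_liminf (u i) x \<noteq> \<infinity>" for i
    using resolvent_liminf_integral[OF u[of _ i]]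
    by (intro nn_integral_PInf_AE) (auto simp: top_unique)
  then have "AE x in M. \<forall>i\<in>UNIV. resolvent_liminf (u i) x \<noteq> \<infinity>"
    by (intro AE_finite_allI) auto
  then have inv: "AE x in M. invertible (A x)"
  proof (rule AE_mp, intro AE_I2 impI)
    fix x assume fin: "\<forall>i\<in>UNIV. resolvent_liminf (u i) x \<noteq> \<infinity>"
    show "invertible (A x)"
      unfolding invertible_left_inverse matrix_left_invertible_ker
    proof (intro allI impI)
      fix w assume "A x *v w = 0"
      then have "u i \<bullet> w = 0" for i using resolvent_liminf_kernel[of x w "u i"] fin by auto
      then show "w = 0" by (subst dec) simp
    qed
  qed
  \<comment> \<open>Modifying \<open>A\<close> on a null set makes it invertible everywhere, so Cramer's rule gives measurability.\<close>
  define J where "J x = (if det (A x) = 0 then mat 1 else A x)" for x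
  have J: "det (J x) \<noteq> 0" for x by (simp add: J_def)
  have [measurable]: "(\<lambda>x. det (A x)) \<in> borel_measurable M" unfolding det_def by measurable
  have [measurable]: "(\<lambda>x. J x $ i $ j) \<in> borel_measurable M" for i j
    unfolding J_def by (simp add: if_distrib[of "\<lambda>f. f $ _ $ _"])
  have J_inv [measurable]: "(\<lambda>x. matrix_inv (J x) *v w) \<in> borel_measurable M" for w
    by (rule borel_measurable_matrix_inv_mult) (use J in auto)
  define S where "S x = (\<Sum>i\<in>UNIV. norm (A x *v v i))" for x
  define T where "T x = (\<Sum>i\<in>UNIV. norm (matrix_inv (J x) *v u i))" for x
  show ?thesis
  proof (rule that[of S T "\<Sum>i\<in>UNIV. norm (u i)" "\<Sum>i\<in>UNIV. norm (v i)"])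
    show "S \<in> borel_measurable M" "T \<in> borel_measurable M"
      unfolding S_def[abs_def] T_def[abs_def] by measurable
    show S0: "0 \<le> S x" and T0: "0 \<le> T x" for x by (auto simp: S_def T_def intro!: sum_nonneg)
    have "(\<integral>\<^sup>+x. ennreal (S x powr p) \<partial>M) \<le>
        (\<integral>\<^sup>+x. ennreal (real CARD('d) powr p) * (\<Sum>i\<in>UNIV. ennreal (norm (A x *v v i) powr p)) \<partial>M)"
      unfolding S_def using exponents
      by (intro nn_integral_mono)
         (auto simp: sum_ennreal ennreal_mult[symmetric] sum_nonneg intro!: ennreal_leI powr_sum_le)
    also have "\<dots> = ennreal (real CARD('d) powr p) * (\<Sum>i\<in>UNIV. ennreal (N (v i)))"
      by (subst nn_integral_cmult, measurable, subst nn_integral_sum)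
         (auto simp: nn_integral_N simp del: sum_ennreal)
    also have "\<dots> \<le> ennreal (real CARD('d) powr p) * (\<Sum>i\<in>(UNIV :: 'd set). 1)"
      using v by (intro mult_left_mono sum_mono) auto
    also have "\<dots> = ennreal (real CARD('d) powr (p + 1))"
      by (simp add: powr_add ennreal_mult ennreal_of_nat_eq_real_of_nat)
    finally show "(\<integral>\<^sup>+x. ennreal (S x powr p) \<partial>M) \<le> ennreal (real CARD('d) powr (p + 1))" .
    have "(\<integral>\<^sup>+x. ennreal (T x powr p') \<partial>M) \<le>
        (\<integral>\<^sup>+x. ennreal (real CARD('d) powr p' * 2 powr p') * (\<Sum>i\<in>UNIV. resolvent_liminf (u i) x) \<partial>M)"
    proof (rule nn_integral_mono_AE, rule AE_mp[OF inv], intro AE_I2 impI)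
      fix x assume x: "invertible (A x)"
      have "ennreal (T x powr p') \<le> ennreal (real CARD('d) powr p') * (\<Sum>i\<in>UNIV. ennreal (norm (matrix_inv (J x) *v u i) powr p'))"
        unfolding T_def using exponents
        by (auto simp: sum_ennreal ennreal_mult[symmetric] sum_nonneg intro!: ennreal_leI powr_sum_le)
      also have "\<dots> \<le> ennreal (real CARD('d) powr p') * (\<Sum>i\<in>UNIV. ennreal (2 powr p') * resolvent_liminf (u i) x)"
        using x inverse_le_resolvent_liminf[OF x]
        by (intro mult_left_mono sum_mono) (auto simp: J_def invertible_det_nz)
      finally show "ennreal (T x powr p') \<le>
        ennreal (real CARD('d) powr p' * 2 powr p') * (\<Sum>i\<in>UNIV. resolvent_liminf (u i) x)"
        by (simp add: sum_distrib_left[symmetric] ennreal_mult mult.assoc)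
    qed
    also have "\<dots> = ennreal (real CARD('d) powr p' * 2 powr p') * (\<Sum>i\<in>UNIV. \<integral>\<^sup>+x. resolvent_liminf (u i) x \<partial>M)"
      by (subst nn_integral_cmult) (auto simp: nn_integral_sum)
    also have "\<dots> \<le> ennreal (real CARD('d) powr p' * 2 powr p') * (\<Sum>i\<in>(UNIV :: 'd set). ennreal (C powr p'))"
      using u by (intro mult_left_mono sum_mono resolvent_liminf_integral) auto
    also have "\<dots> = ennreal (real CARD('d) powr (p' + 1) * (2 * C) powr p')"
      by (simp add: powr_add powr_mult ennreal_mult[symmetric] ennreal_of_nat_eq_real_of_nat mult_ac)
    finally show "(\<integral>\<^sup>+x. ennreal (T x powr p') \<partial>M) \<le> ennreal (real CARD('d) powr (p' + 1) * (2 * C) powr p')" .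
    show "norm (A x *v z) \<le> (\<Sum>i\<in>UNIV. norm (u i)) * S x * norm z" for x z
    proof -
      have "A x *v z = (\<Sum>i\<in>UNIV. (u i \<bullet> z) *\<^sub>R (A x *v v i))"
        by (subst dec) (simp add: linear_sum[OF matrix_vector_mul_linear] matrix_vector_mult_scaleR)
      also have "norm \<dots> \<le> (\<Sum>i\<in>UNIV. norm (u i) * (S x * norm z))"
      proof (intro sum_norm_le)
        fix i
        have "norm (A x *v v i) \<le> S x"
          unfolding S_def by (rule member_le_sum) auto
        then have "\<bar>u i \<bullet> z\<bar> * norm (A x *v v i) \<le> (norm (u i) * norm z) * S x"
          by (intro mult_mono Cauchy_Schwarz_ineq2) auto
        then show "norm ((u i \<bullet> z) *\<^sub>R (A x *v v i)) \<le> norm (u i) * (S x * norm z)"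
          by (simp add: mult_ac)
      qed
      finally show ?thesis by (simp add: sum_distrib_right mult.assoc)
    qed
    show "AE y in M. invertible (A y) \<and>
      (\<forall>z. norm (matrix_inv (A y) *v z) \<le> (\<Sum>i\<in>UNIV. norm (v i)) * T y * norm z) \<and>
      (\<forall>x z. norm (A x *v (matrix_inv (A y) *v z)) \<le> S x * T y * norm z)"
    proof (rule AE_mp[OF inv], intro AE_I2 impI)
      fix y assume y: "invertible (A y)"
      let ?I = "matrix_inv (A y)"
      have self: "(A y *v h) \<bullet> k = h \<bullet> (A y *v k)" for h k
        by (metis dot_lmul_matrix sym vector_transpose_matrix)
      have I: "A y *v (?I *v z) = z" for z using y by (simp add: matrix_vector_mul_assoc matrix_inv_right)
      have I_self: "w \<bullet> (?I *v z) = (?I *v w) \<bullet> z" for w z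
        using self[of "?I *v w" "?I *v z"] by (simp add: I)
      have "norm (?I *v u i) \<le> T y" for i
        unfolding T_def using y
        by (auto simp: J_def invertible_det_nz intro!: member_le_sum[of i UNIV "\<lambda>i. norm (?I *v u i)"])
      then have coeff: "\<bar>u i \<bullet> (?I *v z)\<bar> \<le> T y * norm z" for i z
        unfolding I_self by (meson Cauchy_Schwarz_ineq2 mult_right_mono norm_ge_zero order_trans)
      \<comment> \<open>Used with \<open>L\<close> the identity and with \<open>L = A x\<close>.\<close>
      have "norm (L (?I *v z)) \<le> (\<Sum>i\<in>UNIV. norm (L (v i))) * T y * norm z"
        if "linear L" for L :: "real ^ 'd \<Rightarrow> real ^ 'd" and z
      proof -
        have "L (?I *v z) = (\<Sum>i\<in>UNIV. (u i \<bullet> (?I *v z)) *\<^sub>R L (v i))"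
          by (subst dec) (simp add: linear_sum[OF that] linear_scale[OF that])
        also have "norm \<dots> \<le> (\<Sum>i\<in>UNIV. T y * norm z * norm (L (v i)))"
          using coeff by (intro sum_norm_le) (auto intro!: mult_right_mono)
        finally show ?thesis by (simp add: sum_distrib_left[symmetric] mult_ac)
      qed
      from this[of "\<lambda>z. z"] this[of "\<lambda>z. A _ *v z"] y
      show "invertible (A y) \<and>
        (\<forall>z. norm (?I *v z) \<le> (\<Sum>i\<in>UNIV. norm (v i)) * T y * norm z) \<and>
        (\<forall>x z. norm (A x *v (?I *v z)) \<le> S x * T y * norm z)"
        by (auto simp: S_def linear_id[unfolded id_def])
    qed
  qed
qed

end

section \<open>Extended-valued matrices\<close>

lemma ext_dot_ext_vec:
  "ext_dot a (ext_vec v) =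
    (if (\<Sum>k\<in>UNIV. inf_sign (a $ k) * v $ k) \<noteq> 0
     then ereal (sgn (\<Sum>k\<in>UNIV. inf_sign (a $ k) * v $ k)) * \<infinity>
     else ereal (\<Sum>k\<in>UNIV. fin_part (a $ k) * v $ k))"
  by (simp add: ext_dot_def ext_vec_def inf_sign_def fin_part_def)

lemma ext_dot_finite:
  "(\<And>k. \<bar>a $ k\<bar> \<noteq> \<infinity>) \<Longrightarrow> ext_dot a (ext_vec v) = ereal (\<Sum>k\<in>UNIV. real_of_ereal (a $ k) * v $ k)"
proof -
  assume "\<And>k. \<bar>a $ k\<bar> \<noteq> \<infinity>"
  then have "inf_sign (a $ k) = 0" for k unfolding inf_sign_def by (metis abs_ereal.simps(2,3))
  then show ?thesis by (simp add: ext_dot_ext_vec fin_part_def)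
qed

lemma ext_dot_ext_vec_ext_vec: "ext_dot (ext_vec w) (ext_vec v) = ereal (w \<bullet> v)"
proof -
  have "ext_vec w $ k = ereal (w $ k)" for k by (simp add: ext_vec_def)
  then show ?thesis by (simp add: ext_dot_ext_vec inf_sign_def fin_part_def inner_vec_def)
qed

lemma ext_mult_vec_finite:
  "finite_matrix A \<Longrightarrow> ext_mult_vec A (ext_vec v) = ext_vec (real_matrix A *v v)"
  by (simp add: ext_mult_vec_def vec_eq_iff ext_dot_finite finite_matrix_def matrix_vector_mult_def
      real_matrix_def) (simp add: ext_vec_def)

lemma ext_norm_ext_vec [simp]: "ext_norm (ext_vec w) = ennreal (norm w)"
  by (simp add: ext_norm_def ext_vec_def)

lemma ext_mult_vec_0 [simp]: "ext_mult_vec A (ext_vec 0) = ext_vec 0"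
  by (simp add: ext_mult_vec_def vec_eq_iff ext_dot_ext_vec) (simp add: ext_vec_def)

lemma ext_mult_mat_ext_inv:
  assumes "finite_matrix A"
  shows "finite_matrix (ext_mult_mat A (ext_inv B))"
    and "real_matrix (ext_mult_mat A (ext_inv B)) = real_matrix A ** matrix_inv (real_matrix B)"
proof -
  have "(\<chi> k. ext_inv B $ k $ j) = ext_vec (\<chi> k. matrix_inv (real_matrix B) $ k $ j)" for j
    by (simp add: ext_inv_def ext_vec_def vec_eq_iff)
  then have *: "ext_mult_mat A (ext_inv B) $ i $ j =
      ereal ((real_matrix A ** matrix_inv (real_matrix B)) $ i $ j)" for i j
    using assms
    by (simp add: ext_mult_mat_def ext_dot_finite finite_matrix_def matrix_matrix_mult_def real_matrix_def)
  show "finite_matrix (ext_mult_mat A (ext_inv B))" by (simp add: finite_matrix_def *)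
  show "real_matrix (ext_mult_mat A (ext_inv B)) = real_matrix A ** matrix_inv (real_matrix B)"
    unfolding real_matrix_def[of "ext_mult_mat A (ext_inv B)"] * by (simp add: vec_eq_iff)
qed

lemma ext_inv_finite: "finite_matrix (ext_inv B)" "real_matrix (ext_inv B) = matrix_inv (real_matrix B)"
  by (simp_all add: finite_matrix_def ext_inv_def real_matrix_def vec_eq_iff)

lemma ext_op_norm_finite:
  "finite_matrix A \<Longrightarrow> ext_op_norm A = (SUP v\<in>{v. norm v = 1}. ennreal (norm (real_matrix A *v v)))"
  by (simp add: ext_op_norm_def ext_mult_vec_finite)

lemma ext_op_norm_le:
  assumes "finite_matrix A" "\<And>z. norm (real_matrix A *v z) \<le> c * norm z"
  shows "ext_op_norm A \<le> ennreal c"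
  using assms(2) unfolding ext_op_norm_finite[OF assms(1)]
  by (intro SUP_least ennreal_leI) (metis mem_Collect_eq mult.right_neutral)

text \<open>
  A general finite vector may cancel infinite entries of a row, as in \<open>\<infinity> - \<infinity> = 0\<close>; a coordinate
  vector cannot.
\<close>

lemma finite_matrix_if_columns_finite:
  assumes "\<And>j. ext_norm (ext_mult_vec A (ext_vec (axis j 1))) < \<infinity>"
  shows "finite_matrix A"
  unfolding finite_matrix_def
proof (intro allI notI)
  fix i j assume inf: "\<bar>A $ i $ j\<bar> = \<infinity>"
  have "(\<Sum>k\<in>UNIV. inf_sign (A $ i $ k) * axis j 1 $ k) = inf_sign (A $ i $ j)"
    by (simp add: axis_def if_distrib[of "\<lambda>x. _ * x"] cong: if_cong)
  moreover have "inf_sign (A $ i $ j) = 1 \<or> inf_sign (A $ i $ j) = -1"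
    using inf by (auto simp: inf_sign_def)
  ultimately have "\<bar>ext_mult_vec A (ext_vec (axis j 1)) $ i\<bar> = \<infinity>"
    by (auto simp: ext_mult_vec_def ext_dot_ext_vec)
  then have "\<exists>i. \<bar>ext_mult_vec A (ext_vec (axis j 1)) $ i\<bar> = \<infinity>" by (rule exI)
  then have "ext_norm (ext_mult_vec A (ext_vec (axis j 1))) = \<infinity>"
    by (simp only: ext_norm_def if_True)
  with assms[of j] show False by simp
qed

lemma measurable_ext_norm [measurable (raw)]:
  assumes [measurable]: "\<And>i. (\<lambda>x. f x $ i) \<in> borel_measurable M"
  shows "(\<lambda>x. ext_norm (f x)) \<in> borel_measurable M"
proof -
  have [measurable]: "(\<lambda>x. \<chi> i. real_of_ereal (f x $ i)) \<in> borel_measurable M"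
    by (rule borel_measurable_vecI) simp
  show ?thesis unfolding ext_norm_def by measurable
qed

lemma measurable_ext_mult_vec [measurable (raw)]:
  assumes [measurable]: "\<And>i j. (\<lambda>x. W x $ i $ j) \<in> borel_measurable M" "f \<in> borel_measurable M"
  shows "(\<lambda>x. ext_mult_vec (W x) (ext_vec (f x)) $ i) \<in> borel_measurable M"
  unfolding ext_mult_vec_def ext_dot_ext_vec inf_sign_def fin_part_def by simp measurable

text \<open>
  The supremum is uncountable, but it is a supremum of continuous functions and hence lower
  semicontinuous.
\<close>

lemma measurable_sup_unit_sphere:
  "(\<lambda>R :: real ^ 'd ^ 'd. SUP v\<in>{v. norm v = 1}. ennreal (norm (R *v v))) \<in> borel_measurable borel"
proof (rule borel_measurableI_greater)
  fix a :: ennreal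
  have "open {R :: real ^ 'd ^ 'd. a < ennreal (norm (R *v v))}" for v
    by (intro open_Collect_less continuous_intros continuous_on_ennreal)
       (auto simp: matrix_vector_mult_def intro!: continuous_intros)
  then have "open (\<Union>v\<in>{v. norm v = 1}. {R :: real ^ 'd ^ 'd. a < ennreal (norm (R *v v))})" by auto
  moreover have "{R \<in> space borel. a < (SUP v\<in>{v. norm v = 1}. ennreal (norm (R *v v)))} =
      (\<Union>v\<in>{v. norm v = 1}. {R :: real ^ 'd ^ 'd. a < ennreal (norm (R *v v))})"
    by (auto simp: less_SUP_iff)
  ultimately show "{R :: real ^ 'd ^ 'd \<in> space borel. a < (SUP v\<in>{v. norm v = 1}. ennreal (norm (R *v v)))} \<in> sets borel"
    by simp
qed

section \<open>Null sets, chains and averages\<close>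

text \<open>
  Completeness of Lebesgue measure.
\<close>

lemma borel_measurable_lebesgue_on_AE_cong:
  fixes f g :: "'a::euclidean_space \<Rightarrow> 'b::topological_space"
  assumes g: "g \<in> borel_measurable lebesgue" and U: "U \<in> sets lebesgue"
    and eq: "AE x in lebesgue. x \<in> U \<longrightarrow> f x = g x"
  shows "f \<in> borel_measurable (lebesgue_on U)"
proof -
  obtain N where N: "N \<in> null_sets lebesgue" "{x \<in> space lebesgue. \<not> (x \<in> U \<longrightarrow> f x = g x)} \<subseteq> N"
    using eq unfolding eventually_ae_filter by blast
  define f' where "f' x = (if x \<in> U then f x else g x)" for x
  have f': "f' x = g x" if "x \<notin> N" for x using N(2) that by (auto simp: f'_def)
  have "f' \<in> borel_measurable lebesgue"
  proof (rule measurableI)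
    fix S :: "'b set" assume S: "S \<in> sets borel"
    have "f' -` S \<inter> N \<in> null_sets lebesgue"
      using N(1) by (intro completion.complete2[OF _ N(1)]) auto
    then have "(g -` S - N) \<union> (f' -` S \<inter> N) \<in> sets lebesgue"
      using measurable_sets[OF g S] N(1) by (auto)
    also have "(g -` S - N) \<union> (f' -` S \<inter> N) = f' -` S \<inter> space lebesgue"
      using f' by auto
    finally show "f' -` S \<inter> space lebesgue \<in> sets lebesgue" .
  qed auto
  then have "f' \<in> borel_measurable (lebesgue_on U)" by (rule measurable_restrict_space1)
  then show ?thesis
    by (rule measurable_cong[THEN iffD1, rotated]) (simp add: f'_def)
qed

text \<open>
  By Lindelof's theorem countably many members of \<open>F\<close> already cover the union.
\<close>

lemma AE_open_Union:
  fixes F :: "'a::euclidean_space set set"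
  assumes F: "\<And>B. B \<in> F \<Longrightarrow> open B" and P: "\<And>B. B \<in> F \<Longrightarrow> AE x in lebesgue. x \<in> B \<longrightarrow> P x"
  shows "AE x in lebesgue. x \<in> \<Union>F \<longrightarrow> P x"
proof -
  obtain F' where F': "F' \<subseteq> F" "countable F'" "\<Union>F' = \<Union>F"
    using Lindelof[of F] F by blast
  have "AE x in lebesgue. \<forall>B\<in>F'. x \<in> B \<longrightarrow> P x"
    using F' P by (subst AE_ball_countable) auto
  then show ?thesis unfolding F'(3)[symmetric] by (rule AE_mp) auto
qed

text \<open>
  Overlapping is symmetric, so each step of a chain can also be taken backwards.
\<close>

lemma chain_rel_invariant:
  assumes step: "\<And>B B'. B \<in> \<B> \<Longrightarrow> B' \<in> \<B> \<Longrightarrow> B \<inter> B' \<noteq> {} \<Longrightarrow> Q B \<Longrightarrow> Q B'"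
    and rel: "(B, B') \<in> chain_rel \<B>"
  shows "Q B \<longleftrightarrow> Q B'"
proof -
  obtain S and k :: nat where S: "S 0 = B" "S k = B'" "\<And>i. i \<le> k \<Longrightarrow> S i \<in> \<B>"
    "\<And>i. i \<in> {1..k} \<Longrightarrow> S (i - 1) \<inter> S i \<noteq> {}"
    using rel unfolding chain_rel_def by auto
  have "i \<le> k \<Longrightarrow> Q (S 0) \<longleftrightarrow> Q (S i)" for i
  proof (induction i)
    case (Suc i)
    then have "S i \<inter> S (Suc i) \<noteq> {}" using S(4)[of "Suc i"] by simp
    then have "Q (S i) \<longleftrightarrow> Q (S (Suc i))"
      using step[of "S i" "S (Suc i)"] step[of "S (Suc i)" "S i"] S(3) Suc.prems by (auto simp: Int_commute)
    with Suc show ?case by simp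
  qed simp
  from this[of k] S show ?thesis by simp
qed

text \<open>
  In the applications \<open>G\<close> is built from uncountable suprema over unit vectors; a measurable majorant
  carries the computation.
\<close>

lemma avg_le_uniform:
  assumes B: "B \<in> sets lebesgue" and H: "H \<in> borel_measurable lebesgue"
    and le: "AE x in lebesgue. x \<in> B \<longrightarrow> G x \<le> H x"
  shows "avg B G \<le> (\<integral>\<^sup>+x. H x \<partial>uniform_measure lebesgue B)"
  unfolding avg_def nn_integral_uniform_measure[OF H B]
proof (intro divide_right_mono_ennreal nn_integral_mono_AE)
  show "AE x in lebesgue. G x * indicator B x \<le> H x * indicator B x"
    using le by (rule AE_mp) (auto simp: indicator_def)
qed

section \<open>The dichotomy on chain classes\<close>

text \<open>
  The part of the weak Muckenhoupt property that the argument retains: the supremum over the basis is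
  replaced by a single set, with a constant common to all sets, and test functions are finite-valued.
\<close>

locale averaging_bounded_basis =
  fixes \<B> :: "(real ^ 'n) set set" and W :: "real ^ 'n \<Rightarrow> ereal ^ 'd ^ 'd" and p C :: real
  assumes basis: "basis_family \<B>"
    and W_measurable [measurable]: "\<And>i j. (\<lambda>x. W x $ i $ j) \<in> borel_measurable lebesgue"
    and p: "1 < p" and C: "0 < C"
    and averaging: "\<And>B f. B \<in> \<B> \<Longrightarrow> f \<in> borel_measurable lebesgue \<Longrightarrow>
      (\<integral>\<^sup>+x. enn_powr (\<integral>\<^sup>+y. ext_norm (ext_mult_vec (W x) (ext_vec (f y))) \<partial>uniform_measure lebesgue B) p
          * indicator B x \<partial>lebesgue)
        \<le> ennreal (C powr p) *
          (\<integral>\<^sup>+x. enn_powr (ext_norm (ext_mult_vec (W x) (ext_vec (f x)))) p * indicator B x \<partial>lebesgue)"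

text \<open>
  Test the maximal operator with \<open>f\<close> cut off to \<open>B\<close>.  Making the constant at least 1 covers the case in
  which the right-hand side is infinite and \<open>f\<close> is not in the weighted space.
\<close>

lemma weak_muckenhoupt_averaging:
  fixes \<B> :: "(real ^ 'n) set set" and W :: "real ^ 'n \<Rightarrow> ereal ^ 'd ^ 'd"
  assumes basis: "basis_family \<B>" and W: "ext_matrix_function (\<Union>\<B>) W" and p: "1 < p"
    and weak: "weak_muckenhoupt \<B> W p"
  obtains C where "averaging_bounded_basis \<B> W p C"
proof -
  have Wm [measurable]: "(\<lambda>x. W x $ i $ j) \<in> borel_measurable lebesgue" for i j
    using W by (simp add: ext_matrix_function_def)
  obtain C0 where C0: "\<And>f. f \<in> Lp_weighted p W \<Longrightarrow> Lp_norm p (maximal_op \<B> W f)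
          \<le> ennreal C0 * Lp_norm p (\<lambda>x. ext_norm (ext_mult_vec (W x) (f x)))"
    using weak unfolding weak_muckenhoupt_def by blast
  define C where "C = max C0 1"
  have C: "0 < C" and C_le: "ennreal C0 \<le> ennreal C" by (auto simp: C_def intro!: ennreal_leI)
  have "averaging_bounded_basis \<B> W p C"
  proof
    fix B and f :: "real ^ 'n \<Rightarrow> real ^ 'd"
    assume B: "B \<in> \<B>" and f [measurable]: "f \<in> borel_measurable lebesgue"
    have Bm [measurable]: "B \<in> sets lebesgue" using basis B by (auto simp: basis_family_def)
    let ?F = "\<lambda>y. ext_vec (indicator B y *\<^sub>R f y)"
    let ?n = "\<lambda>x y. ext_norm (ext_mult_vec (W x) (ext_vec (f y)))"
    have F: "ext_norm (ext_mult_vec (W x) (?F y)) = ?n x y * indicator B y" for x y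
      by (auto simp: indicator_def)
    define R where "R = (\<integral>\<^sup>+x. enn_powr (?n x x) p * indicator B x \<partial>lebesgue)"
    have R: "(\<integral>\<^sup>+x. enn_powr (ext_norm (ext_mult_vec (W x) (?F x))) p \<partial>lebesgue) = R"
      unfolding R_def F by (intro nn_integral_cong) (auto simp: indicator_def)
    show "(\<integral>\<^sup>+x. enn_powr (\<integral>\<^sup>+y. ?n x y \<partial>uniform_measure lebesgue B) p * indicator B x \<partial>lebesgue)
        \<le> ennreal (C powr p) * (\<integral>\<^sup>+x. enn_powr (?n x x) p * indicator B x \<partial>lebesgue)"
      unfolding R_def[symmetric]
    proof (cases "R = \<infinity>")
      case True
      then show "(\<integral>\<^sup>+x. enn_powr (\<integral>\<^sup>+y. ?n x y \<partial>uniform_measure lebesgue B) p * indicator B x \<partial>lebesgue)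
        \<le> ennreal (C powr p) * R"
        using C by (simp add: ennreal_mult_top)
    next
      case False
      have "?F \<in> Lp_weighted p W"
        unfolding Lp_weighted_def mem_Collect_eq R using False by (simp add: less_top) (simp add: ext_vec_def)
      from C0[OF this] have "Lp_norm p (maximal_op \<B> W ?F) \<le> ennreal C * enn_powr R (1 / p)"
        unfolding Lp_norm_def R using mult_right_mono[OF C_le] by (meson order_trans zero_le)
      then have "enn_powr (Lp_norm p (maximal_op \<B> W ?F)) p \<le> enn_powr (ennreal C * enn_powr R (1 / p)) p"
        using p by (intro enn_powr_mono) auto
      then have le: "(\<integral>\<^sup>+x. enn_powr (maximal_op \<B> W ?F x) p \<partial>lebesgue) \<le> ennreal (C powr p) * R"
        using p C unfolding Lp_norm_def by (simp add: enn_powr_enn_powr enn_powr_mult enn_powr_ennreal)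
      have "enn_powr (\<integral>\<^sup>+y. ?n x y \<partial>uniform_measure lebesgue B) p * indicator B x \<le> enn_powr (maximal_op \<B> W ?F x) p" for x
      proof (cases "x \<in> B")
        case True
        have [measurable]: "(\<lambda>y. ?n x y) \<in> borel_measurable lebesgue" by measurable
        have "(\<integral>\<^sup>+y. ?n x y \<partial>uniform_measure lebesgue B) = avg B (\<lambda>y. ext_norm (ext_mult_vec (W x) (?F y))) * indicator B x"
          using True unfolding F avg_def by (simp add: nn_integral_uniform_measure mult.assoc flip: indicator_inter_arith)
        also have "\<dots> \<le> maximal_op \<B> W ?F x" unfolding maximal_op_def using B by (intro SUP_upper)
        finally show ?thesis using True p by (simp add: enn_powr_mono)
      qed simp
      then have "(\<integral>\<^sup>+x. enn_powr (\<integral>\<^sup>+y. ?n x y \<partial>uniform_measure lebesgue B) p * indicator B x \<partial>lebesgue)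
         \<le> (\<integral>\<^sup>+x. enn_powr (maximal_op \<B> W ?F x) p \<partial>lebesgue)" by (rule nn_integral_mono)
      with le show "(\<integral>\<^sup>+x. enn_powr (\<integral>\<^sup>+y. ?n x y \<partial>uniform_measure lebesgue B) p * indicator B x \<partial>lebesgue)
        \<le> ennreal (C powr p) * R" by (rule order_trans[rotated])
    qed
  qed (use basis p C in auto)
  then show ?thesis by (rule that)
qed

context averaging_bounded_basis
begin

abbreviation Wnorm :: "real ^ 'd \<Rightarrow> real ^ 'n \<Rightarrow> ennreal" where
  "Wnorm v x \<equiv> ext_norm (ext_mult_vec (W x) (ext_vec v))"

lemma basisD:
  assumes "B \<in> \<B>"
  shows "open B" "B \<in> sets lebesgue" "0 < emeasure lebesgue B" "emeasure lebesgue B < \<infinity>"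
proof -
  show "open B" "emeasure lebesgue B < \<infinity>" using basis assms by (auto simp: basis_family_def)
  then show "B \<in> sets lebesgue" by auto
  have "B \<noteq> {}" using basis assms by (auto simp: basis_family_def)
  then show "0 < emeasure lebesgue B"
    using \<open>open B\<close> open_not_negligible[of B] by (auto simp: negligible_iff_emeasure0 zero_less_iff_neq_zero)
qed

text \<open>
  The test function is \<open>1\<^sub>E v\<close>.  Taking \<open>v\<close> constant on \<open>E\<close> makes the inner average equal to
  \<open>\<bar>W(x) v\<bar> \<bar>E\<bar> / \<bar>B\<bar>\<close>, even where \<open>W(x)\<close> has infinite entries.
\<close>

lemma doubling:
  assumes B: "B \<in> \<B>" and E [measurable]: "E \<in> sets lebesgue" and "E \<subseteq> B"
  shows "enn_powr (emeasure lebesgue E / emeasure lebesgue B) p * (\<integral>\<^sup>+x\<in>B. enn_powr (Wnorm v x) p \<partial>lebesgue)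
    \<le> ennreal (C powr p) * (\<integral>\<^sup>+x\<in>E. enn_powr (Wnorm v x) p \<partial>lebesgue)"
proof -
  note [measurable] = basisD(2)[OF B]
  have split: "ext_norm (ext_mult_vec (W x) (ext_vec (indicator E y *\<^sub>R v))) = Wnorm v x * indicator E y" for x y
    by (auto simp: indicator_def)
  have "B \<inter> E = E" using \<open>E \<subseteq> B\<close> by auto
  then have inner: "(\<integral>\<^sup>+y. Wnorm v x * indicator E y \<partial>uniform_measure lebesgue B) =
      emeasure lebesgue E / emeasure lebesgue B * Wnorm v x" for x
    by (subst nn_integral_cmult) (auto simp: mult.commute)
  have "(\<integral>\<^sup>+x. enn_powr (emeasure lebesgue E / emeasure lebesgue B * Wnorm v x) p * indicator B x \<partial>lebesgue)
    \<le> ennreal (C powr p) * (\<integral>\<^sup>+x. enn_powr (Wnorm v x * indicator E x) p * indicator B x \<partial>lebesgue)"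
    using averaging[OF B, of "\<lambda>y. indicator E y *\<^sub>R v"] unfolding split inner by simp
  also have "(\<integral>\<^sup>+x. enn_powr (Wnorm v x * indicator E x) p * indicator B x \<partial>lebesgue) =
      (\<integral>\<^sup>+x\<in>E. enn_powr (Wnorm v x) p \<partial>lebesgue)"
    using \<open>E \<subseteq> B\<close> by (intro nn_integral_cong) (auto simp: indicator_def)
  finally show ?thesis
    by (simp add: enn_powr_mult mult.assoc nn_integral_cmult)
qed

lemma ratio_pos:
  assumes "B \<in> \<B>" "0 < emeasure lebesgue E"
  shows "0 < enn_powr (emeasure lebesgue E / emeasure lebesgue B) p"
  using basisD(4)[OF assms(1)] assms(2)
  by (auto simp: zero_less_iff_neq_zero ennreal_divide_eq_0_iff)

lemma zero_propagates:
  assumes B: "B \<in> \<B>" and pos: "\<not> (AE x in lebesgue. x \<in> B \<longrightarrow> Wnorm v x \<noteq> 0)"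
  shows "AE x in lebesgue. x \<in> B \<longrightarrow> Wnorm v x = 0"
proof -
  note [measurable] = basisD(2)[OF B]
  let ?E = "{x \<in> B. Wnorm v x = 0}"
  have "{x \<in> space lebesgue. x \<in> B \<and> Wnorm v x = 0} \<in> sets lebesgue" by measurable
  then have E [measurable]: "?E \<in> sets lebesgue" by simp
  have "emeasure lebesgue ?E \<noteq> 0"
    using pos AE_iff_measurable[OF E, of "\<lambda>x. x \<in> B \<longrightarrow> Wnorm v x \<noteq> 0"] by auto
  then have r: "0 < enn_powr (emeasure lebesgue ?E / emeasure lebesgue B) p"
    by (intro ratio_pos B) (simp add: zero_less_iff_neq_zero)
  have "(\<integral>\<^sup>+x\<in>?E. enn_powr (Wnorm v x) p \<partial>lebesgue) = 0"
    by (auto simp: indicator_def intro!: nn_integral_0_iff_AE[THEN iffD2] AE_I2)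
  with doubling[OF B E, of v] r have "(\<integral>\<^sup>+x\<in>B. enn_powr (Wnorm v x) p \<partial>lebesgue) = 0" by auto
  then have "AE x in lebesgue. enn_powr (Wnorm v x) p * indicator B x = 0"
    by (subst (asm) nn_integral_0_iff_AE) auto
  then show ?thesis by (rule AE_mp) (auto simp: indicator_def)
qed

text \<open>
  \<open>W v\<close> is bounded on some subset of \<open>B\<close> of positive measure, to which \<open>doubling\<close> applies.
\<close>

lemma finite_propagates:
  assumes B: "B \<in> \<B>" and pos: "\<not> (AE x in lebesgue. x \<in> B \<longrightarrow> Wnorm v x = \<infinity>)"
  shows "(\<integral>\<^sup>+x\<in>B. enn_powr (Wnorm v x) p \<partial>lebesgue) < \<infinity>"
proof -
  note [measurable] = basisD(2)[OF B]
  define E where "E n = {x \<in> B. Wnorm v x \<le> of_nat n}" for n :: nat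
  have "{x \<in> space lebesgue. x \<in> B \<and> Wnorm v x \<le> of_nat n} \<in> sets lebesgue" for n by measurable
  then have E [measurable]: "E n \<in> sets lebesgue" for n by (simp add: E_def)
  have "\<exists>n. emeasure lebesgue (E n) \<noteq> 0"
  proof (rule ccontr)
    assume "\<not> (\<exists>n. emeasure lebesgue (E n) \<noteq> 0)"
    then have "AE x in lebesgue. x \<notin> E n" for n
      using E by (intro AE_not_in) (auto simp: null_sets_def)
    then have "AE x in lebesgue. \<forall>n. x \<notin> E n" by (simp add: AE_all_countable)
    then have "AE x in lebesgue. x \<in> B \<longrightarrow> Wnorm v x = \<infinity>"
    proof (rule AE_mp, intro AE_I2 impI)
      fix x assume x: "\<forall>n. x \<notin> E n" "x \<in> B"
      show "Wnorm v x = \<infinity>"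
      proof (rule ccontr)
        assume "Wnorm v x \<noteq> \<infinity>"
        then obtain n where "Wnorm v x \<le> of_nat n"
          by (metis ennreal_Ex_less_of_nat infinity_ennreal_def less_imp_le less_top)
        with x show False by (auto simp: E_def)
      qed
    qed
    with pos show False by simp
  qed
  then obtain n where n: "emeasure lebesgue (E n) \<noteq> 0" by auto
  have "E n \<subseteq> B" by (auto simp: E_def)
  have "(\<integral>\<^sup>+x\<in>E n. enn_powr (Wnorm v x) p \<partial>lebesgue) \<le> (\<integral>\<^sup>+x. enn_powr (of_nat n) p * indicator B x \<partial>lebesgue)"
    using p by (intro nn_integral_mono) (auto simp: E_def indicator_def intro!: enn_powr_mono)
  also have "\<dots> = enn_powr (of_nat n) p * emeasure lebesgue B" by (simp add: nn_integral_cmult_indicator)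
  also have "\<dots> < \<infinity>"
    using basisD(4)[OF B] unfolding infinity_ennreal_def
    by (intro ennreal_mult_less_top[THEN iffD2] disjI2 conjI) (simp_all add: of_nat_less_top)
  finally have "ennreal (C powr p) * (\<integral>\<^sup>+x\<in>E n. enn_powr (Wnorm v x) p \<partial>lebesgue) < \<infinity>"
    by (auto simp: ennreal_mult_less_top)
  then have "enn_powr (emeasure lebesgue (E n) / emeasure lebesgue B) p * (\<integral>\<^sup>+x\<in>B. enn_powr (Wnorm v x) p \<partial>lebesgue) < \<infinity>"
    using doubling[OF B E \<open>E n \<subseteq> B\<close>, of v] by (rule le_less_trans[rotated])
  moreover have "0 < enn_powr (emeasure lebesgue (E n) / emeasure lebesgue B) p"
    using n by (intro ratio_pos B) (simp add: zero_less_iff_neq_zero)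
  ultimately show ?thesis by (auto simp: ennreal_mult_less_top)
qed

lemma finite_propagates_AE:
  assumes B: "B \<in> \<B>" and pos: "\<not> (AE x in lebesgue. x \<in> B \<longrightarrow> Wnorm v x = \<infinity>)"
  shows "AE x in lebesgue. x \<in> B \<longrightarrow> Wnorm v x < \<infinity>"
proof -
  note [measurable] = basisD(2)[OF B]
  have "AE x in lebesgue. enn_powr (Wnorm v x) p * indicator B x \<noteq> \<infinity>"
    using finite_propagates[OF assms] by (intro nn_integral_PInf_AE) (auto simp: less_top)
  then show ?thesis by (rule AE_mp) (auto simp: indicator_def simp flip: less_top)
qed

lemma overlap_not_null:
  assumes "B \<in> \<B>" "B' \<in> \<B>" "B \<inter> B' \<noteq> {}"
  shows "\<not> (AE x in lebesgue. x \<in> B \<longrightarrow> x \<notin> B')"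
proof
  have "open (B \<inter> B')" using basisD(1) assms by blast
  then have pos: "emeasure lebesgue (B \<inter> B') \<noteq> 0" and B: "B \<inter> B' \<in> sets lebesgue"
    using open_not_negligible[of "B \<inter> B'"] assms by (auto simp: negligible_iff_emeasure0)
  assume "AE x in lebesgue. x \<in> B \<longrightarrow> x \<notin> B'"
  then have "emeasure lebesgue (B \<inter> B') = 0"
    using AE_iff_measurable[OF B, of "\<lambda>x. x \<in> B \<longrightarrow> x \<notin> B'"] by auto
  with pos show False by simp
qed

text \<open>
  For each \<open>v\<close>, vanishing a.e. and being infinite a.e. are each shared by all sets of a class or by none.
  If no \<open>v \<noteq> 0\<close> has either property on one set of the class, the propagation lemmas make \<open>W v\<close> finite and nonzero
  a.e. on every set of the class.
\<close>

lemma dichotomy: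
  assumes \<C>: "\<C> \<in> \<B> // chain_rel \<B>"
  shows "nontrivial_on W (\<Union>\<C>) \<or> trivial_on W (\<Union>\<C>)"
proof -
  obtain B0 where B0: "B0 \<in> \<B>" "\<C> = chain_rel \<B> `` {B0}" using \<C> by (auto elim: quotientE)
  have sub: "B \<in> \<B>" and rel: "(B0, B) \<in> chain_rel \<B>" if "B \<in> \<C>" for B
    using that unfolding B0(2) chain_rel_def by auto
  define Z where "Z v B \<longleftrightarrow> (AE x in lebesgue. x \<in> B \<longrightarrow> Wnorm v x = 0)" for v B
  define I where "I v B \<longleftrightarrow> (AE x in lebesgue. x \<in> B \<longrightarrow> Wnorm v x = \<infinity>)" for v B
  have Z: "Z v B \<longleftrightarrow> Z v B0" if "B \<in> \<C>" for v B
  proof (rule chain_rel_invariant[OF _ rel[OF that], symmetric])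
    fix B B' assume BB': "B \<in> \<B>" "B' \<in> \<B>" "B \<inter> B' \<noteq> {}" and "Z v B"
    show "Z v B'"
      unfolding Z_def
    proof (rule zero_propagates[OF BB'(2)], rule notI)
      assume "AE x in lebesgue. x \<in> B' \<longrightarrow> Wnorm v x \<noteq> 0"
      with \<open>Z v B\<close> have "AE x in lebesgue. x \<in> B \<longrightarrow> x \<notin> B'" unfolding Z_def by eventually_elim auto
      with overlap_not_null[OF BB'] show False by simp
    qed
  qed
  have I: "I v B \<longleftrightarrow> I v B0" if "B \<in> \<C>" for v B
  proof (rule chain_rel_invariant[OF _ rel[OF that], symmetric])
    fix B B' assume BB': "B \<in> \<B>" "B' \<in> \<B>" "B \<inter> B' \<noteq> {}" and "I v B"
    show "I v B'"
    proof (rule ccontr)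
      assume "\<not> I v B'"
      then have "AE x in lebesgue. x \<in> B' \<longrightarrow> Wnorm v x < \<infinity>"
        unfolding I_def by (intro finite_propagates_AE BB')
      with \<open>I v B\<close> have "AE x in lebesgue. x \<in> B \<longrightarrow> x \<notin> B'" unfolding I_def by eventually_elim auto
      with overlap_not_null[OF BB'] show False by simp
    qed
  qed
  have glue: "AE x in lebesgue. x \<in> \<Union>\<C> \<longrightarrow> P x" if "\<And>B. B \<in> \<C> \<Longrightarrow> AE x in lebesgue. x \<in> B \<longrightarrow> P x" for P
    using that sub basisD(1) by (intro AE_open_Union) auto
  show ?thesis
  proof (cases "\<exists>v. v \<noteq> 0 \<and> (Z v B0 \<or> I v B0)")
    case True
    then obtain v where v: "v \<noteq> 0" "Z v B0 \<or> I v B0" by blast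
    have "AE x in lebesgue. x \<in> \<Union>\<C> \<longrightarrow> Wnorm v x = 0" if "Z v B0"
      using Z[of _ v] that unfolding Z_def by (intro glue) blast
    moreover have "AE x in lebesgue. x \<in> \<Union>\<C> \<longrightarrow> Wnorm v x = \<infinity>" if "I v B0"
      using I[of _ v] that unfolding I_def by (intro glue) blast
    ultimately have "(AE x in lebesgue. x \<in> \<Union>\<C> \<longrightarrow> Wnorm v x = 0) \<or> (AE x in lebesgue. x \<in> \<Union>\<C> \<longrightarrow> Wnorm v x = \<infinity>)"
      using v(2) by blast
    with v show ?thesis unfolding trivial_on_def by blast
  next
    case False
    have "nontrivial_on W (\<Union>\<C>)"
      unfolding nontrivial_on_def
    proof (intro allI impI glue)
      fix v :: "real ^ 'd" and B assume v: "v \<noteq> 0" and B: "B \<in> \<C>"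
      then have "\<not> Z v B" "\<not> I v B" using False Z I by blast+
      then have "AE x in lebesgue. x \<in> B \<longrightarrow> Wnorm v x \<noteq> 0" "AE x in lebesgue. x \<in> B \<longrightarrow> Wnorm v x < \<infinity>"
        unfolding Z_def I_def using zero_propagates[OF sub[OF B]] finite_propagates_AE[OF sub[OF B]] by blast+
      then show "AE x in lebesgue. x \<in> B \<longrightarrow> 0 < Wnorm v x \<and> Wnorm v x < \<infinity>"
        by eventually_elim (simp add: zero_less_iff_neq_zero)
    qed
    then show ?thesis ..
  qed
qed

section \<open>Estimates on a nontrivial basis set\<close>

text \<open>
  Nontriviality is tested on coordinate vectors to see that the entries are finite.  Positivity
  holds for each vector outside a null set depending on it; a countable dense set of vectors and
  continuity give one null set for all vectors.  Inside \<open>B\<close> and off this set \<open>A\<close> is \<open>W\<close>; elsewhere it is 0.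
\<close>

lemma real_weight:
  assumes B: "B \<in> \<B>" and nontriv: "nontrivial_on W B"
    and sa: "self_adjoint_ae (\<Union>\<B>) W" and psd: "pos_semidef_ae (\<Union>\<B>) W"
  obtains A where "\<And>i j. (\<lambda>x. A x $ i $ j) \<in> borel_measurable lebesgue"
    and "\<And>x. transpose (A x) = A x" "\<And>x v. 0 \<le> (A x *v v) \<bullet> v"
    and "AE x in lebesgue. x \<in> B \<longrightarrow> finite_matrix (W x) \<and> A x = real_matrix (W x)"
proof -
  note [measurable] = basisD(2)[OF B]
  obtain D :: "(real ^ 'd) set" where D: "countable D" "\<And>U. open U \<Longrightarrow> U \<noteq> {} \<Longrightarrow> \<exists>d\<in>D. d \<in> U"
    using countable_dense_exists by blast
  let ?P = "\<lambda>x. finite_matrix (W x) \<and> transpose (W x) = W x \<and>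
      (\<forall>v\<in>D. 0 \<le> ext_dot (ext_mult_vec (W x) (ext_vec v)) (ext_vec v))"
  have "AE x in lebesgue. \<forall>j\<in>UNIV. x \<in> B \<longrightarrow> Wnorm (axis j 1) x < \<infinity>"
  proof (intro AE_finite_allI)
    fix j :: 'd
    have "axis j (1 :: real) \<noteq> 0" by (simp add: axis_eq_0_iff)
    then show "AE x in lebesgue. x \<in> B \<longrightarrow> Wnorm (axis j 1) x < \<infinity>"
      using nontriv unfolding nontrivial_on_def by fastforce
  qed simp
  moreover have "AE x in lebesgue. x \<in> B \<longrightarrow> transpose (W x) = W x"
    using sa unfolding self_adjoint_ae_def by (rule AE_mp) (use B in auto)
  moreover have "AE x in lebesgue. \<forall>v\<in>D. x \<in> B \<longrightarrow> 0 \<le> ext_dot (ext_mult_vec (W x) (ext_vec v)) (ext_vec v)"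
  proof (subst AE_ball_countable[OF D(1)], intro ballI)
    show "AE x in lebesgue. x \<in> B \<longrightarrow> 0 \<le> ext_dot (ext_mult_vec (W x) (ext_vec v)) (ext_vec v)" for v
      using psd[unfolded pos_semidef_ae_def, rule_format, of v] by (rule AE_mp) (use B in auto)
  qed
  ultimately have "AE x in lebesgue. x \<in> B \<longrightarrow> ?P x"
    by eventually_elim (auto intro: finite_matrix_if_columns_finite)
  then obtain N where N: "N \<in> null_sets lebesgue" "{x \<in> space lebesgue. \<not> (x \<in> B \<longrightarrow> ?P x)} \<subseteq> N"
    unfolding eventually_ae_filter by blast
  have N' [measurable]: "N \<in> sets lebesgue" using N(1) by auto
  have P: "?P x" if "x \<in> B - N" for x using N(2) that by auto
  define A where "A x = (if x \<in> B - N then real_matrix (W x) else 0)" for x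
  show ?thesis
  proof (rule that[of A])
    have "A x $ i $ j = (if x \<in> B - N then real_of_ereal (W x $ i $ j) else 0)" for x i j
      by (simp add: A_def real_matrix_def)
    then show "(\<lambda>x. A x $ i $ j) \<in> borel_measurable lebesgue" for i j by simp
    show "transpose (A x) = A x" for x
      using P[of x] by (auto simp: A_def real_matrix_def transpose_def vec_eq_iff)
    show "0 \<le> (A x *v v) \<bullet> v" for x v
    proof (cases "x \<in> B - N")
      case True
      let ?R = "real_matrix (W x)"
      have dense: "0 \<le> (?R *v w) \<bullet> w" if "w \<in> D" for w
      proof -
        have "ext_dot (ext_mult_vec (W x) (ext_vec w)) (ext_vec w) = ereal ((?R *v w) \<bullet> w)"
          using P[OF True] by (simp add: ext_mult_vec_finite ext_dot_ext_vec_ext_vec)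
        then show ?thesis using P[OF True] that by (metis ereal_less_eq(5))
      qed
      have "open {w. (?R *v w) \<bullet> w < 0}"
        by (intro open_Collect_less continuous_intros matrix_vector_mult_linear_continuous_on)
      with D(2) dense have "{w. (?R *v w) \<bullet> w < 0} = {}" by (metis (mono_tags, lifting) mem_Collect_eq not_less)
      then show ?thesis using True by (auto simp: A_def not_less)
    qed (auto simp: A_def)
    show "AE x in lebesgue. x \<in> B \<longrightarrow> finite_matrix (W x) \<and> A x = real_matrix (W x)"
      using AE_not_in[OF N(1)] by (rule AE_mp) (use P in \<open>auto simp: A_def\<close>)
  qed
qed

text \<open>
  Transfers \<open>kernel_factorization\<close> to the extended-valued weight.  The averaging hypothesis follows from
  \<open>\<bar>A(x) \<integral> f\<bar> \<le> \<integral> \<bar>A(x) f(y)\<bar> dy\<close>, and its two norm hypotheses from nontriviality.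
\<close>

lemma ball_estimates:
  assumes B: "B \<in> \<B>" and nontriv: "nontrivial_on W B"
    and sa: "self_adjoint_ae (\<Union>\<B>) W" and psd: "pos_semidef_ae (\<Union>\<B>) W"
    and p': "1 / p + 1 / p' = 1"
  obtains S T :: "real ^ 'n \<Rightarrow> real" and K' K :: real
  where "S \<in> borel_measurable lebesgue" "T \<in> borel_measurable lebesgue" "\<And>x. 0 \<le> S x" "\<And>x. 0 \<le> T x"
    and "(\<integral>\<^sup>+x. ennreal (S x powr p) \<partial>uniform_measure lebesgue B) \<le> ennreal (real CARD('d) powr (p + 1))"
    and "(\<integral>\<^sup>+x. ennreal (T x powr p') \<partial>uniform_measure lebesgue B)
      \<le> ennreal (real CARD('d) powr (p' + 1) * (2 * C) powr p')"
    and "AE x in lebesgue. x \<in> B \<longrightarrow> finite_invertible (W x) \<and>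
      ext_op_norm (W x) \<le> ennreal (K' * S x) \<and> ext_op_norm (ext_inv (W x)) \<le> ennreal (K * T x)"
    and "AE x in lebesgue. x \<in> B \<longrightarrow> (AE y in lebesgue. y \<in> B \<longrightarrow>
      ext_op_norm (ext_mult_mat (W x) (ext_inv (W y))) \<le> ennreal (S x * T y))"
proof -
  note Bm [measurable] = basisD(2)[OF B]
  define \<mu> where "\<mu> = uniform_measure lebesgue B"
  obtain A where A [measurable]: "\<And>i j. (\<lambda>x. A x $ i $ j) \<in> borel_measurable lebesgue"
    and A_sym: "\<And>x. transpose (A x) = A x" and A_psd: "\<And>x v. 0 \<le> (A x *v v) \<bullet> v"
    and WA: "AE x in lebesgue. x \<in> B \<longrightarrow> finite_matrix (W x) \<and> A x = real_matrix (W x)"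
    using real_weight[OF B nontriv sa psd] by blast
  have sets_\<mu> [measurable_cong]: "sets \<mu> = sets lebesgue" by (simp add: \<mu>_def)
  have nn: "(\<integral>\<^sup>+x. g x \<partial>\<mu>) = (\<integral>\<^sup>+x. g x * indicator B x \<partial>lebesgue) / emeasure lebesgue B"
    if "g \<in> borel_measurable lebesgue" for g
    unfolding \<mu>_def using that by (intro nn_integral_uniform_measure) auto
  have AE_\<mu>: "(AE x in \<mu>. P x) \<longleftrightarrow> (AE x in lebesgue. x \<in> B \<longrightarrow> P x)" for P
    unfolding \<mu>_def using basisD(3,4)[OF B] by (intro AE_uniform_measure) auto
  have Wn: "Wnorm v x = ennreal (norm (A x *v v))" if "finite_matrix (W x) \<and> A x = real_matrix (W x)" for x v
    using that by (simp add: ext_mult_vec_finite)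
  have "emeasure lebesgue B / emeasure lebesgue B = 1"
    using basisD(3,4)[OF B] by (intro ennreal_divide_self) auto
  then have "emeasure \<mu> (space \<mu>) \<noteq> \<infinity>"
    unfolding \<mu>_def by (simp del: emeasure_completion)
  then interpret finite_measure \<mu> by (rule finite_measureI)
  interpret averaging_bounded_weight \<mu> A p p' C
  proof
    show "(\<lambda>x. A x $ i $ j) \<in> borel_measurable \<mu>" for i j by measurable
    show "(\<integral>\<^sup>+ x. ennreal (norm (A x *v v) powr p) \<partial>\<mu>) < \<infinity>" for v
    proof -
      have "\<not> (AE x in lebesgue. x \<in> B \<longrightarrow> Wnorm v x = \<infinity>)"
      proof
        assume "AE x in lebesgue. x \<in> B \<longrightarrow> Wnorm v x = \<infinity>"
        with WA have "AE x in lebesgue. x \<in> B \<longrightarrow> x \<notin> B" by eventually_elim (auto simp: Wn)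
        with overlap_not_null[of B B] B basisD(3)[OF B] show False by force
      qed
      then have fin: "(\<integral>\<^sup>+x\<in>B. enn_powr (Wnorm v x) p \<partial>lebesgue) < \<infinity>" by (rule finite_propagates[OF B])
      have "(\<integral>\<^sup>+ x. ennreal (norm (A x *v v) powr p) * indicator B x \<partial>lebesgue) =
          (\<integral>\<^sup>+x\<in>B. enn_powr (Wnorm v x) p \<partial>lebesgue)"
        by (rule nn_integral_cong_AE, rule AE_mp[OF WA], rule AE_I2) (auto simp: Wn enn_powr_ennreal indicator_def)
      with fin show ?thesis
        using basisD(3)[OF B] by (subst nn) (auto simp: ennreal_divide_eq_top_iff simp flip: less_top)
    qed
    show "v = 0" if "AE x in \<mu>. A x *v v = 0" for v
    proof (rule ccontr)
      assume "v \<noteq> 0"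
      then have "AE x in lebesgue. x \<in> B \<longrightarrow> 0 < Wnorm v x" using nontriv unfolding nontrivial_on_def by fastforce
      with that[unfolded AE_\<mu>] WA have "AE x in lebesgue. x \<in> B \<longrightarrow> x \<notin> B" by eventually_elim (auto simp: Wn)
      with overlap_not_null[of B B] B basisD(3)[OF B] show False by force
    qed
    fix f :: "real ^ 'n \<Rightarrow> real ^ 'd" and R
    assume f_meas: "f \<in> borel_measurable \<mu>" and f_bound: "\<And>x. norm (f x) \<le> R"
    have f [measurable]: "f \<in> borel_measurable lebesgue" using f_meas by measurable
    have f_int: "integrable \<mu> f" using f_bound by (intro integrable_const_bound f_meas) auto
    let ?F = "\<integral>y. f y \<partial>\<mu>"
    have "(\<integral>\<^sup>+ x. ennreal (norm (A x *v ?F) powr p) * indicator B x \<partial>lebesgue)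
      \<le> (\<integral>\<^sup>+x. enn_powr (\<integral>\<^sup>+y. ext_norm (ext_mult_vec (W x) (ext_vec (f y))) \<partial>\<mu>) p * indicator B x \<partial>lebesgue)"
    proof (rule nn_integral_mono_AE, rule AE_mp[OF WA], intro AE_I2 impI)
      fix x assume x: "x \<in> B \<longrightarrow> finite_matrix (W x) \<and> A x = real_matrix (W x)"
      have "ennreal (norm (A x *v ?F)) = ennreal (norm (\<integral>y. A x *v f y \<partial>\<mu>))"
        by (simp add: integral_bounded_linear[OF matrix_vector_mul_bounded_linear f_int])
      also have "\<dots> \<le> (\<integral>\<^sup>+y. ennreal (norm (A x *v f y)) \<partial>\<mu>)"
        by (intro integral_norm_bound_ennreal integrable_bounded_linear[OF matrix_vector_mul_bounded_linear f_int])
      finally have "enn_powr (ennreal (norm (A x *v ?F))) p \<le> enn_powr (\<integral>\<^sup>+y. ennreal (norm (A x *v f y)) \<partial>\<mu>) p"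
        using p by (intro enn_powr_mono) auto
      then show "ennreal (norm (A x *v ?F) powr p) * indicator B x \<le>
          enn_powr (\<integral>\<^sup>+y. ext_norm (ext_mult_vec (W x) (ext_vec (f y))) \<partial>\<mu>) p * indicator B x"
        using x by (auto simp: indicator_def Wn enn_powr_ennreal)
    qed
    also have "\<dots> \<le> ennreal (C powr p) *
        (\<integral>\<^sup>+x. enn_powr (ext_norm (ext_mult_vec (W x) (ext_vec (f x)))) p * indicator B x \<partial>lebesgue)"
      unfolding \<mu>_def by (rule averaging[OF B f])
    also have "(\<integral>\<^sup>+x. enn_powr (ext_norm (ext_mult_vec (W x) (ext_vec (f x)))) p * indicator B x \<partial>lebesgue) =
        (\<integral>\<^sup>+x. ennreal (norm (A x *v f x) powr p) * indicator B x \<partial>lebesgue)"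
      by (rule nn_integral_cong_AE, rule AE_mp[OF WA], rule AE_I2) (auto simp: Wn enn_powr_ennreal indicator_def)
    finally show "(\<integral>\<^sup>+ x. ennreal (norm (A x *v ?F) powr p) \<partial>\<mu>)
        \<le> ennreal (C powr p) * (\<integral>\<^sup>+ x. ennreal (norm (A x *v f x) powr p) \<partial>\<mu>)"
      by (subst (1 2) nn) (auto simp: ennreal_times_divide intro!: divide_right_mono_ennreal)
  qed (rule A_sym A_psd p p' C)+
  obtain S T :: "real ^ 'n \<Rightarrow> real" and K' K :: real
    where ST: "S \<in> borel_measurable \<mu>" "T \<in> borel_measurable \<mu>" "\<And>x. 0 \<le> S x" "\<And>x. 0 \<le> T x"
    "(\<integral>\<^sup>+x. ennreal (S x powr p) \<partial>\<mu>) \<le> ennreal (real CARD('d) powr (p + 1))"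
    "(\<integral>\<^sup>+x. ennreal (T x powr p') \<partial>\<mu>) \<le> ennreal (real CARD('d) powr (p' + 1) * (2 * C) powr p')"
    and K': "\<And>x z. norm (A x *v z) \<le> K' * S x * norm z"
    and AE: "AE y in \<mu>. invertible (A y) \<and>
      (\<forall>z. norm (matrix_inv (A y) *v z) \<le> K * T y * norm z) \<and>
      (\<forall>x z. norm (A x *v (matrix_inv (A y) *v z)) \<le> S x * T y * norm z)"
    by (rule kernel_factorization) (rule that)
  have good: "AE y in lebesgue. y \<in> B \<longrightarrow> finite_matrix (W y) \<and> A y = real_matrix (W y) \<and> invertible (A y) \<and>
      (\<forall>z. norm (matrix_inv (A y) *v z) \<le> K * T y * norm z) \<and>
      (\<forall>x z. norm (A x *v (matrix_inv (A y) *v z)) \<le> S x * T y * norm z)"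
    using WA AE[unfolded AE_\<mu>] by eventually_elim auto
  show ?thesis
  proof (rule that[of S T K' K])
    show "S \<in> borel_measurable lebesgue" "T \<in> borel_measurable lebesgue"
      using ST(1,2) by measurable
    show "AE x in lebesgue. x \<in> B \<longrightarrow> finite_invertible (W x) \<and>
      ext_op_norm (W x) \<le> ennreal (K' * S x) \<and> ext_op_norm (ext_inv (W x)) \<le> ennreal (K * T x)"
    proof (rule AE_mp[OF good], intro AE_I2 impI conjI)
      fix x assume "x \<in> B \<longrightarrow> finite_matrix (W x) \<and> A x = real_matrix (W x) \<and> invertible (A x) \<and>
        (\<forall>z. norm (matrix_inv (A x) *v z) \<le> K * T x * norm z) \<and>
        (\<forall>y z. norm (A y *v (matrix_inv (A x) *v z)) \<le> S y * T x * norm z)" "x \<in> B"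
      then have x: "finite_matrix (W x)" "A x = real_matrix (W x)" "invertible (A x)"
        "\<And>z. norm (matrix_inv (A x) *v z) \<le> K * T x * norm z" by auto
      show "finite_invertible (W x)" using x by (simp add: finite_invertible_def)
      show "ext_op_norm (W x) \<le> ennreal (K' * S x)"
        using K'[of x] x by (intro ext_op_norm_le) auto
      show "ext_op_norm (ext_inv (W x)) \<le> ennreal (K * T x)"
        using x by (intro ext_op_norm_le) (auto simp: ext_inv_finite)
    qed
    show "AE x in lebesgue. x \<in> B \<longrightarrow> (AE y in lebesgue. y \<in> B \<longrightarrow>
      ext_op_norm (ext_mult_mat (W x) (ext_inv (W y))) \<le> ennreal (S x * T y))"
    proof (rule AE_mp[OF good], rule AE_I2, intro impI)
      fix x assume x: "x \<in> B \<longrightarrow> finite_matrix (W x) \<and> A x = real_matrix (W x) \<and> invertible (A x) \<and>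
        (\<forall>z. norm (matrix_inv (A x) *v z) \<le> K * T x * norm z) \<and>
        (\<forall>y z. norm (A y *v (matrix_inv (A x) *v z)) \<le> S y * T x * norm z)" "x \<in> B"
      show "AE y in lebesgue. y \<in> B \<longrightarrow>
          ext_op_norm (ext_mult_mat (W x) (ext_inv (W y))) \<le> ennreal (S x * T y)"
        using good
      proof eventually_elim
        case (elim y)
        show ?case
        proof
          assume y: "y \<in> B"
          have eqs: "finite_matrix (W x)" "real_matrix (W x) = A x" "real_matrix (W y) = A y" using elim x y by auto
          have "norm (A x *v (matrix_inv (A y) *v z)) \<le> S x * T y * norm z" for z using elim y by blast
          then show "ext_op_norm (ext_mult_mat (W x) (ext_inv (W y))) \<le> ennreal (S x * T y)"
            using eqs by (intro ext_op_norm_le) (simp_all add: ext_mult_mat_ext_inv flip: matrix_vector_mul_assoc)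
        qed
      qed
    qed
  qed (use ST in \<open>auto simp: \<mu>_def\<close>)
qed

end

section \<open>Local integrability and the Muckenhoupt condition\<close>

text \<open>
  Finitely many members of \<open>F\<close> cover \<open>K\<close>; on each of them \<open>h B\<close> is an integrable majorant.
\<close>

lemma nn_integral_compact_less_top:
  fixes F :: "'a::euclidean_space set set"
  assumes F: "\<And>B. B \<in> F \<Longrightarrow> open B" and K: "compact K" "K \<subseteq> \<Union>F"
    and h: "\<And>B. B \<in> F \<Longrightarrow> h B \<in> borel_measurable lebesgue"
    and le: "\<And>B. B \<in> F \<Longrightarrow> AE x in lebesgue. x \<in> B \<longrightarrow> g x \<le> h B x"
    and fin: "\<And>B. B \<in> F \<Longrightarrow> (\<integral>\<^sup>+x\<in>B. h B x \<partial>lebesgue) < \<infinity>"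
  shows "(\<integral>\<^sup>+x\<in>K. g x \<partial>lebesgue) < \<infinity>"
proof -
  obtain F' where F': "F' \<subseteq> F" "finite F'" "K \<subseteq> \<Union>F'"
    using compactE[OF K(1) K(2)] F by blast
  have m: "(\<lambda>x. h B x * indicator B x) \<in> borel_measurable lebesgue" if "B \<in> F'" for B
  proof -
    have [measurable]: "h B \<in> borel_measurable lebesgue" "B \<in> sets lebesgue"
      using h F F'(1) that by auto
    show ?thesis by measurable
  qed
  have "AE x in lebesgue. \<forall>B\<in>F'. x \<in> B \<longrightarrow> g x \<le> h B x"
    using le F' by (intro AE_finite_allI) auto
  then have "AE x in lebesgue. g x * indicator K x \<le> (\<Sum>B\<in>F'. h B x * indicator B x)"
  proof (rule AE_mp, intro AE_I2 impI)
    fix x assume x: "\<forall>B\<in>F'. x \<in> B \<longrightarrow> g x \<le> h B x"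
    show "g x * indicator K x \<le> (\<Sum>B\<in>F'. h B x * indicator B x)"
    proof (cases "x \<in> K")
      case True
      then obtain B where B: "B \<in> F'" "x \<in> B" using F'(3) by auto
      then have "g x * indicator K x \<le> h B x * indicator B x" using x True by simp
      also have "\<dots> \<le> (\<Sum>B\<in>F'. h B x * indicator B x)" using B F'(2) by (intro member_le_sum) auto
      finally show ?thesis .
    qed simp
  qed
  then have "(\<integral>\<^sup>+x\<in>K. g x \<partial>lebesgue) \<le> (\<integral>\<^sup>+x. (\<Sum>B\<in>F'. h B x * indicator B x) \<partial>lebesgue)"
    by (rule nn_integral_mono_AE)
  also have "\<dots> = (\<Sum>B\<in>F'. \<integral>\<^sup>+x\<in>B. h B x \<partial>lebesgue)" using m by (rule nn_integral_sum)
  also have "\<dots> < \<infinity>" using fin F' by (auto simp: less_top[symmetric] ennreal_sum_less_top subset_iff)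
  finally show ?thesis .
qed

lemma Lp_locI:
  assumes g: "g \<in> borel_measurable (lebesgue_on (\<Union>F))" and q: "0 < q"
    and F: "\<And>B. B \<in> F \<Longrightarrow> open B \<and> emeasure lebesgue B \<noteq> 0 \<and> emeasure lebesgue B < \<infinity>"
    and dom: "\<And>B. B \<in> F \<Longrightarrow> \<exists>S K. S \<in> borel_measurable lebesgue \<and> (\<forall>x. 0 \<le> S x) \<and>
      (AE x in lebesgue. x \<in> B \<longrightarrow> g x \<le> ennreal (K * S x)) \<and>
      (\<integral>\<^sup>+x. ennreal (S x powr q) \<partial>uniform_measure lebesgue B) < \<infinity>"
  shows "g \<in> Lp_loc q (\<Union>F)"
proof -
  have "\<exists>h. h \<in> borel_measurable lebesgue \<and> (AE x in lebesgue. x \<in> B \<longrightarrow> enn_powr (g x) q \<le> h x) \<and>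
      (\<integral>\<^sup>+x\<in>B. h x \<partial>lebesgue) < \<infinity>" if B: "B \<in> F" for B
  proof -
    obtain S K where S [measurable]: "S \<in> borel_measurable lebesgue" and S0: "\<And>x. 0 \<le> S x"
      and le: "AE x in lebesgue. x \<in> B \<longrightarrow> g x \<le> ennreal (K * S x)"
      and fin: "(\<integral>\<^sup>+x. ennreal (S x powr q) \<partial>uniform_measure lebesgue B) < \<infinity>"
      using dom[OF B] by blast
    have Bm [measurable]: "B \<in> sets lebesgue" using F[OF B] by auto
    let ?h = "\<lambda>x. ennreal (\<bar>K\<bar> powr q) * ennreal (S x powr q)"
    have "AE x in lebesgue. x \<in> B \<longrightarrow> enn_powr (g x) q \<le> ?h x"
    proof (rule AE_mp[OF le], intro AE_I2 impI)
      fix x assume "x \<in> B \<longrightarrow> g x \<le> ennreal (K * S x)" "x \<in> B"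
      then have "g x \<le> ennreal (K * S x)" by simp
      also have "\<dots> \<le> ennreal (\<bar>K\<bar> * S x)" using S0 by (intro ennreal_leI mult_right_mono) auto
      finally have "enn_powr (g x) q \<le> enn_powr (ennreal (\<bar>K\<bar> * S x)) q" using q by (intro enn_powr_mono) auto
      also have "\<dots> = ?h x" using S0[of x] by (simp add: enn_powr_ennreal enn_powr_mult ennreal_mult)
      finally show "enn_powr (g x) q \<le> ?h x" .
    qed
    moreover have "(\<integral>\<^sup>+x\<in>B. ?h x \<partial>lebesgue) = ennreal (\<bar>K\<bar> powr q) * (\<integral>\<^sup>+x\<in>B. ennreal (S x powr q) \<partial>lebesgue)"
      by (simp add: mult.assoc nn_integral_cmult)
    moreover have "(\<integral>\<^sup>+x\<in>B. ennreal (S x powr q) \<partial>lebesgue) < \<infinity>"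
      using fin F[OF B] by (auto simp: nn_integral_uniform_measure ennreal_divide_eq_top_iff less_top[symmetric])
    ultimately show ?thesis by (intro exI[of _ ?h]) (auto simp: ennreal_mult_less_top)
  qed
  then have "\<forall>B\<in>F. \<exists>h. h \<in> borel_measurable lebesgue \<and> (AE x in lebesgue. x \<in> B \<longrightarrow> enn_powr (g x) q \<le> h x) \<and>
      (\<integral>\<^sup>+x\<in>B. h x \<partial>lebesgue) < \<infinity>" by blast
  from bchoice[OF this] obtain h where h: "\<forall>B\<in>F. h B \<in> borel_measurable lebesgue \<and>
      (AE x in lebesgue. x \<in> B \<longrightarrow> enn_powr (g x) q \<le> h B x) \<and> (\<integral>\<^sup>+x\<in>B. h B x \<partial>lebesgue) < \<infinity>"
    by blast
  show ?thesis
    unfolding Lp_loc_def mem_Collect_eq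
  proof (intro conjI g allI impI)
    fix K assume "compact K \<and> K \<subseteq> \<Union>F"
    then show "(\<integral>\<^sup>+x\<in>K. enn_powr (g x) q \<partial>lebesgue) < \<infinity>"
      using F h by (intro nn_integral_compact_less_top[of F K h]) simp_all
  qed
qed

lemma measurable_ext_op_norm:
  fixes W :: "real ^ 'n \<Rightarrow> ereal ^ 'd ^ 'd"
  assumes Wm [measurable]: "\<And>i j. (\<lambda>x. W x $ i $ j) \<in> borel_measurable lebesgue"
    and U: "U \<in> sets lebesgue" and fin: "AE x in lebesgue. x \<in> U \<longrightarrow> finite_invertible (W x)"
  shows "(\<lambda>x. ext_op_norm (W x)) \<in> borel_measurable (lebesgue_on U)"
    and "(\<lambda>x. ext_op_norm (ext_inv (W x))) \<in> borel_measurable (lebesgue_on U)"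
proof -
  let ?\<phi> = "\<lambda>R :: real ^ 'd ^ 'd. SUP v\<in>{v. norm v = 1}. ennreal (norm (R *v v))"
  have comp: "(\<lambda>x. ?\<phi> (G x)) \<in> borel_measurable lebesgue"
    if "\<And>i j. (\<lambda>x. G x $ i $ j) \<in> borel_measurable lebesgue" for G :: "real ^ 'n \<Rightarrow> real ^ 'd ^ 'd"
    using that by (intro measurable_compose[OF _ measurable_sup_unit_sphere] borel_measurable_vecI)
  define R where "R x = real_matrix (W x)" for x
  have R [measurable]: "(\<lambda>x. R x $ i $ j) \<in> borel_measurable lebesgue" for i j
    unfolding R_def real_matrix_def by simp
  show "(\<lambda>x. ext_op_norm (W x)) \<in> borel_measurable (lebesgue_on U)"
    using fin by (intro borel_measurable_lebesgue_on_AE_cong[OF comp[OF R] U])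
      (auto elim!: AE_mp simp: finite_invertible_def ext_op_norm_finite R_def)
  define J where "J x = (if det (R x) = 0 then mat 1 else R x)" for x
  have [measurable]: "(\<lambda>x. det (R x)) \<in> borel_measurable lebesgue" unfolding det_def by measurable
  have J [measurable]: "(\<lambda>x. J x $ i $ j) \<in> borel_measurable lebesgue" for i j
  proof -
    have "J x $ i $ j = (if det (R x) = 0 then mat 1 $ i $ j else R x $ i $ j)" for x by (simp add: J_def)
    then show ?thesis by simp
  qed
  have "(\<lambda>x. matrix_inv (J x) *v axis j 1) \<in> borel_measurable lebesgue" for j
    by (rule borel_measurable_matrix_inv_mult[OF J]) (auto simp: J_def)
  then have "(\<lambda>x. (matrix_inv (J x) *v axis j 1) $ i) \<in> borel_measurable lebesgue" for i j
    by measurable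
  then have J_inv: "(\<lambda>x. matrix_inv (J x) $ i $ j) \<in> borel_measurable lebesgue" for i j
    by (simp add: matrix_vector_mult_basis column_def)
  show "(\<lambda>x. ext_op_norm (ext_inv (W x))) \<in> borel_measurable (lebesgue_on U)"
    using fin by (intro borel_measurable_lebesgue_on_AE_cong[OF comp[OF J_inv] U])
      (auto elim!: AE_mp simp: finite_invertible_def ext_op_norm_finite ext_inv_finite R_def J_def invertible_det_nz)
qed

lemma avg_kernel_le:
  assumes B: "B \<in> sets lebesgue" and p: "0 < p" "0 < p'"
    and S [measurable]: "S \<in> borel_measurable lebesgue" and T [measurable]: "T \<in> borel_measurable lebesgue"
    and S0: "\<And>x. 0 \<le> S x" and T0: "\<And>x. 0 \<le> T x"
    and S_int: "(\<integral>\<^sup>+x. ennreal (S x powr p) \<partial>uniform_measure lebesgue B) \<le> ennreal s"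
    and T_int: "(\<integral>\<^sup>+x. ennreal (T x powr p') \<partial>uniform_measure lebesgue B) \<le> ennreal t" and t: "0 \<le> t"
    and k: "AE x in lebesgue. x \<in> B \<longrightarrow> (AE y in lebesgue. y \<in> B \<longrightarrow> k x y \<le> ennreal (S x * T y))"
  shows "avg B (\<lambda>x. enn_powr (avg B (\<lambda>y. enn_powr (k x y) p')) (p / p')) \<le> ennreal (t powr (p / p')) * ennreal s"
proof -
  let ?\<mu> = "uniform_measure lebesgue B"
  have "AE x in lebesgue. x \<in> B \<longrightarrow> enn_powr (avg B (\<lambda>y. enn_powr (k x y) p')) (p / p')
      \<le> ennreal (t powr (p / p')) * ennreal (S x powr p)"
  proof (rule AE_mp[OF k], intro AE_I2 impI)
    fix x assume "x \<in> B \<longrightarrow> (AE y in lebesgue. y \<in> B \<longrightarrow> k x y \<le> ennreal (S x * T y))" "x \<in> B"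
    then have kx: "AE y in lebesgue. y \<in> B \<longrightarrow> k x y \<le> ennreal (S x * T y)" by simp
    have "avg B (\<lambda>y. enn_powr (k x y) p') \<le> (\<integral>\<^sup>+y. ennreal (S x powr p') * ennreal (T y powr p') \<partial>?\<mu>)"
    proof (rule avg_le_uniform[OF B _ AE_mp[OF kx AE_I2]], measurable, intro impI)
      fix y assume "y \<in> B \<longrightarrow> k x y \<le> ennreal (S x * T y)" "y \<in> B"
      then have "enn_powr (k x y) p' \<le> enn_powr (ennreal (S x * T y)) p'" using p by (intro enn_powr_mono) auto
      then show "enn_powr (k x y) p' \<le> ennreal (S x powr p') * ennreal (T y powr p')"
        using S0[of x] T0[of y] by (simp add: enn_powr_ennreal enn_powr_mult ennreal_mult)
    qed
    also have "\<dots> = ennreal (S x powr p') * (\<integral>\<^sup>+y. ennreal (T y powr p') \<partial>?\<mu>)"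
      by (rule nn_integral_cmult) measurable
    also have "\<dots> \<le> ennreal (S x powr p') * ennreal t" by (intro mult_left_mono T_int) auto
    finally have "enn_powr (avg B (\<lambda>y. enn_powr (k x y) p')) (p / p') \<le> enn_powr (ennreal (S x powr p') * ennreal t) (p / p')"
      using p by (intro enn_powr_mono) auto
    then show "enn_powr (avg B (\<lambda>y. enn_powr (k x y) p')) (p / p') \<le> ennreal (t powr (p / p')) * ennreal (S x powr p)"
      using p t by (simp add: enn_powr_mult enn_powr_ennreal powr_powr mult.commute)
  qed
  then have "avg B (\<lambda>x. enn_powr (avg B (\<lambda>y. enn_powr (k x y) p')) (p / p'))
      \<le> (\<integral>\<^sup>+x. ennreal (t powr (p / p')) * ennreal (S x powr p) \<partial>?\<mu>)"
    by (intro avg_le_uniform[OF B]) measurable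
  also have "\<dots> = ennreal (t powr (p / p')) * (\<integral>\<^sup>+x. ennreal (S x powr p) \<partial>?\<mu>)"
    by (rule nn_integral_cmult) measurable
  also have "\<dots> \<le> ennreal (t powr (p / p')) * ennreal s" by (intro mult_left_mono S_int) auto
  finally show ?thesis .
qed

theorem theorem1p11:
  fixes \<B> :: "(real ^ 'n) set set"
    and W :: "real ^ 'n \<Rightarrow> ereal ^ 'd ^ 'd"
    and p p' :: real
  assumes basis: "basis_family \<B>"
    and W: "ext_matrix_function (\<Union>\<B>) W"
    and W_self_adjoint: "self_adjoint_ae (\<Union>\<B>) W"
    and W_pos_semidef: "pos_semidef_ae (\<Union>\<B>) W"
    and p: "1 < p"
    and p': "1 / p + 1 / p' = 1"
    and weak: "weak_muckenhoupt \<B> W p"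
  shows "(\<forall>\<C> \<in> \<B> // chain_rel \<B>. nontrivial_on W (\<Union>\<C>) \<or> trivial_on W (\<Union>\<C>)) \<and>
    (AE x in lebesgue. x \<in> \<Union>(nontrivial_part \<B> W) \<longrightarrow> finite_invertible (W x)) \<and>
    (\<lambda>x. ext_op_norm (W x)) \<in> Lp_loc p (\<Union>(nontrivial_part \<B> W)) \<and>
    (\<lambda>x. ext_op_norm (ext_inv (W x))) \<in> Lp_loc p' (\<Union>(nontrivial_part \<B> W)) \<and>
    Ap_const (nontrivial_part \<B> W) W p p' < \<infinity>"
proof -
  obtain C where "averaging_bounded_basis \<B> W p C"
    using weak_muckenhoupt_averaging[OF basis W p weak] .
  then interpret averaging_bounded_basis \<B> W p C .
  note exps = conjugate_exponents[OF p p']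
  let ?F = "nontrivial_part \<B> W"
  have F: "B \<in> \<B>" "nontrivial_on W B" if B: "B \<in> ?F" for B
  proof -
    obtain \<C> where \<C>: "\<C> \<in> \<B> // chain_rel \<B>" "nontrivial_on W (\<Union>\<C>)" "B \<in> \<C>"
      using B unfolding nontrivial_part_def by auto
    then show "B \<in> \<B>" unfolding quotient_def chain_rel_def by auto
    show "nontrivial_on W B"
      unfolding nontrivial_on_def
    proof (intro allI impI)
      fix v :: "real ^ 'd" assume "v \<noteq> 0"
      with \<C>(2) have "AE x in lebesgue. x \<in> \<Union>\<C> \<longrightarrow> 0 < Wnorm v x \<and> Wnorm v x < \<infinity>"
        unfolding nontrivial_on_def by blast
      then show "AE x in lebesgue. x \<in> B \<longrightarrow> 0 < Wnorm v x \<and> Wnorm v x < \<infinity>"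
        by (rule AE_mp) (use \<C>(3) in auto)
    qed
  qed
  note est = ball_estimates[OF F W_self_adjoint W_pos_semidef p']
  have inv: "AE x in lebesgue. x \<in> \<Union>?F \<longrightarrow> finite_invertible (W x)"
  proof (rule AE_open_Union)
    show "open B" if "B \<in> ?F" for B using basisD(1)[OF F(1)[OF that]] .
    show "AE x in lebesgue. x \<in> B \<longrightarrow> finite_invertible (W x)" if "B \<in> ?F" for B
      by (rule est[OF that that]) (auto elim!: AE_mp)
  qed
  have "open (\<Union>?F)" using basisD(1) F(1) by blast
  then have U: "\<Union>?F \<in> sets lebesgue" by auto
  have balls: "open B \<and> emeasure lebesgue B \<noteq> 0 \<and> emeasure lebesgue B < \<infinity>" if "B \<in> ?F" for B
    using basisD[OF F(1)[OF that]] by auto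
  have loc: "(\<lambda>x. ext_op_norm (W x)) \<in> Lp_loc p (\<Union>?F)"
  proof (rule Lp_locI[OF measurable_ext_op_norm(1)[OF W_measurable U inv] exps(4) balls])
    fix B assume B: "B \<in> ?F"
    show "\<exists>S K. S \<in> borel_measurable lebesgue \<and> (\<forall>x. 0 \<le> S x) \<and>
      (AE x in lebesgue. x \<in> B \<longrightarrow> ext_op_norm (W x) \<le> ennreal (K * S x)) \<and>
      (\<integral>\<^sup>+x. ennreal (S x powr p) \<partial>uniform_measure lebesgue B) < \<infinity>"
    proof (rule est[OF B B])
      fix S T :: "real ^ 'n \<Rightarrow> real" and K' K
      assume "S \<in> borel_measurable lebesgue" "\<And>x. 0 \<le> S x"
        and int: "(\<integral>\<^sup>+x. ennreal (S x powr p) \<partial>uniform_measure lebesgue B) \<le> ennreal (real CARD('d) powr (p + 1))"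
        and "AE x in lebesgue. x \<in> B \<longrightarrow> finite_invertible (W x) \<and>
          ext_op_norm (W x) \<le> ennreal (K' * S x) \<and> ext_op_norm (ext_inv (W x)) \<le> ennreal (K * T x)"
      then show ?thesis
        using le_less_trans[OF int] by (intro exI[of _ S] exI[of _ K']) (auto elim!: AE_mp)
    qed
  qed
  have loc_inv: "(\<lambda>x. ext_op_norm (ext_inv (W x))) \<in> Lp_loc p' (\<Union>?F)"
  proof (rule Lp_locI[OF measurable_ext_op_norm(2)[OF W_measurable U inv] exps(5) balls])
    fix B assume B: "B \<in> ?F"
    show "\<exists>T K. T \<in> borel_measurable lebesgue \<and> (\<forall>x. 0 \<le> T x) \<and>
      (AE x in lebesgue. x \<in> B \<longrightarrow> ext_op_norm (ext_inv (W x)) \<le> ennreal (K * T x)) \<and>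
      (\<integral>\<^sup>+x. ennreal (T x powr p') \<partial>uniform_measure lebesgue B) < \<infinity>"
    proof (rule est[OF B B])
      fix S T :: "real ^ 'n \<Rightarrow> real" and K' K
      assume "T \<in> borel_measurable lebesgue" "\<And>x. 0 \<le> T x"
        and int: "(\<integral>\<^sup>+x. ennreal (T x powr p') \<partial>uniform_measure lebesgue B)
          \<le> ennreal (real CARD('d) powr (p' + 1) * (2 * C) powr p')"
        and "AE x in lebesgue. x \<in> B \<longrightarrow> finite_invertible (W x) \<and>
          ext_op_norm (W x) \<le> ennreal (K' * S x) \<and> ext_op_norm (ext_inv (W x)) \<le> ennreal (K * T x)"
      then show ?thesis
        using le_less_trans[OF int] by (intro exI[of _ T] exI[of _ K]) (auto elim!: AE_mp)
    qed
  qed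
  define t where "t = real CARD('d) powr (p' + 1) * (2 * C) powr p'"
  have "Ap_const ?F W p p' \<le> enn_powr (ennreal (t powr (p / p')) * ennreal (real CARD('d) powr (p + 1))) (1 / p)"
    unfolding Ap_const_def
  proof (intro SUP_least enn_powr_mono)
    fix B assume B: "B \<in> ?F"
    show "avg B (\<lambda>x. enn_powr (avg B (\<lambda>y. enn_powr (ext_op_norm (ext_mult_mat (W x) (ext_inv (W y)))) p')) (p / p'))
      \<le> ennreal (t powr (p / p')) * ennreal (real CARD('d) powr (p + 1))"
      by (rule est[OF B B]) (rule avg_kernel_le[OF basisD(2)[OF F(1)[OF B]] exps(4,5)], auto simp: t_def)
  qed (use exps in auto)
  also have "\<dots> < \<infinity>" by (auto simp: ennreal_mult_less_top)
  finally show ?thesis using dichotomy inv loc loc_inv by blast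
qed

end
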